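(* Let $K$ be an algebraically closed non-archimedean field with valuation $v:K^{*}\rightarrow\mathbb{R}$ whose residue field $k$ satisfies $\mathrm{char}(k)\neq 2,3$. Let $E$ be an elliptic curve over $K$ with $v(j(E))<0$, where $j(E)$ is the $j$-invariant of $E$. Then there exists an embedding $\phi:E\rightarrow\mathbb{P}^{2}$ such that its tropicalization contains a cycle of length $-v(j(E))$.
   Context: $K$ is not assumed complete, and its valuation need not be discrete. "Embedding" means closed embedding of $K$-varieties. Tropicalization. For a Laurent polynomial $f=\sum_{i\in I}a_i\mathbf{x}^i\in K[x_1^{\pm1},\dots,x_n^{\pm1}]$ (finite sum, $a_i\neq0$), put $\mathrm{trop}(f)(\mathbf{w})=\min_{i\in I}\{v(a_i)+i\cdot\mathbf{w}\}$ for $\mathbf{w}\in\mathbb{R}^n$. The tropical hypersurface $\mathrm{trop}(V(f))\subset\mathbb{R}^n$ is the set of $\mathbf{w}$ at which this minimum is attained by at least two different terms. For an ideal $I$ of the Laurent polynomial ring, $\mathrm{trop}(V(I))=\bigcap_{f\in I}\mathrm{trop}(V(f))$. The tropicalization of an embedding $\phi:E\to\mathbb{P}^2$ is the tropicalization of the curve $C=\phi(E)\cap(K^{*})^2\subset(K^{*})^2$, where $(K^{*})^2\subset\mathbb{P}^2$ is the standard torus, i.e. the complement of the three coordinate lines. For an irreducible curve $C\subset(K^* )^n$, $\mathrm{trop}(C)$ is the support of a polyhedral complex of pure dimension one in $\mathbb{R}^n$ all of whose edges have rational slope, so it has a graph structure with bounded and unbounded edges. Lattice length. Let $e=PQ$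 be a bounded edge of $\mathrm{trop}(C)$ with directional vector $\mathbf{v}=Q-P$, and let $\mathbf{w}\in\mathbb{Z}^n$ be the unique primitive integer vector in the direction of $\mathbf{v}$. Writing $\mathbf{v}=\lambda\mathbf{w}$ with $\lambda\in\mathbb{R}_{\geq0}$, the lattice length of $e$ is $\ell(e)=\lambda$. Cycle. A cycle in $\mathrm{trop}(C)$ is a finite set of bounded edges of $\mathrm{trop}(C)$ that form a leafless connected subgraph of Betti number one, where a leaf is an edge connected to a vertex of valence one. The length of the cycle is the sum of the lattice lengths of its edges. *)

theory Defs
  imports "HOL-Analysis.Analysis" "HOL-Library.Poly_Mapping"
    "HOL-Computational_Algebra.Polynomial" "HOL-Algebra.QuotRing"
begin

section \<open>Valued fields\<close>

text \<open>
  A valuation is a map on nonzero elements; the value \<open>v 0\<close> is arbitrary and is never used.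
\<close>

definition is_valuation :: "('a::field \<Rightarrow> real) \<Rightarrow> bool" where
  "is_valuation v \<longleftrightarrow>
     (\<forall>x y. x \<noteq> 0 \<longrightarrow> y \<noteq> 0 \<longrightarrow> v (x * y) = v x + v y) \<and>
     (\<forall>x y. x \<noteq> 0 \<longrightarrow> y \<noteq> 0 \<longrightarrow> x + y \<noteq> 0 \<longrightarrow> v (x + y) \<ge> min (v x) (v y))"

definition valuation_ring :: "('a::field \<Rightarrow> real) \<Rightarrow> 'a ring" where
  "valuation_ring v =
     \<lparr>carrier = {x. x = 0 \<or> v x \<ge> 0}, mult = (*), one = 1, zero = 0, add = (+)\<rparr>"

definition valuation_ideal :: "('a::field \<Rightarrow> real) \<Rightarrow> 'a set" where
  "valuation_ideal v = {x. x = 0 \<or> v x > 0}"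

definition residue_field :: "('a::field \<Rightarrow> real) \<Rightarrow> 'a set ring" where
  "residue_field v = valuation_ring v Quot valuation_ideal v"

definition ring_char :: "('b, 'c) ring_scheme \<Rightarrow> nat" where
  "ring_char R =
     (if \<exists>n::nat. n > 0 \<and> [n] \<cdot>\<^bsub>R\<^esub> \<one>\<^bsub>R\<^esub> = \<zero>\<^bsub>R\<^esub>
      then LEAST n::nat. n > 0 \<and> [n] \<cdot>\<^bsub>R\<^esub> \<one>\<^bsub>R\<^esub> = \<zero>\<^bsub>R\<^esub> else 0)"

section \<open>Projective varieties and their morphisms\<close>

text \<open>
  Over an algebraically closed field, (reduced) varieties are identified with their sets of
  closed points. A point of projective space is the set of all its vectors of homogeneous
  coordinates; the projective space \<open>P\<^sup>n\<close> has the coordinate index type of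
  cardinality \<open>n + 1\<close>.
\<close>

type_synonym ('a, 'n) pt = "('a ^ 'n) set"

definition proj_pt :: "'a::field ^ 'n \<Rightarrow> ('a, 'n::finite) pt" where
  "proj_pt x = {c *s x | c. c \<noteq> 0}"

definition proj_space :: "('a::field, 'n::finite) pt set" where
  "proj_space = proj_pt ` {x. x \<noteq> 0}"

type_synonym ('a, 'n) mpoly = "(nat ^ 'n) \<Rightarrow>\<^sub>0 'a"

definition mpoly_eval :: "('a::field, 'n::finite) mpoly \<Rightarrow> 'a ^ 'n \<Rightarrow> 'a" where
  "mpoly_eval F x =
     (\<Sum>m\<in>Poly_Mapping.keys F. Poly_Mapping.lookup F m * (\<Prod>i\<in>UNIV. (x $ i) ^ (m $ i)))"

definition homogeneous :: "nat \<Rightarrow> ('a::field, 'n::finite) mpoly \<Rightarrow> bool" where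
  "homogeneous d F \<longleftrightarrow> (\<forall>m\<in>Poly_Mapping.keys F. (\<Sum>i\<in>UNIV. m $ i) = d)"

definition zariski_closed :: "('a::field, 'n::finite) pt set \<Rightarrow> bool" where
  "zariski_closed Z \<longleftrightarrow>
     (\<exists>T. (\<forall>F\<in>T. \<exists>d. homogeneous d F) \<and>
          Z = {p \<in> proj_space. \<forall>F\<in>T. \<forall>x\<in>p. mpoly_eval F x = 0})"

text \<open>
  A morphism from a subvariety \<open>X\<close> of one projective space to another projective space is
  Zariski-locally given by a tuple of forms of equal degree without common zero.
\<close>

definition is_morphism ::
  "('a::field, 'n::finite) pt set \<Rightarrow> (('a, 'n) pt \<Rightarrow> ('a, 'm::finite) pt) \<Rightarrow> bool" where
  "is_morphism X \<phi> \<longleftrightarrow>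
     (\<forall>p\<in>X. \<exists>Z d (F :: 'm \<Rightarrow> ('a, 'n) mpoly).
        zariski_closed Z \<and> p \<notin> Z \<and> (\<forall>i. homogeneous d (F i)) \<and>
        (\<forall>x. x \<noteq> 0 \<longrightarrow> proj_pt x \<in> X - Z \<longrightarrow>
           (\<chi> i. mpoly_eval (F i) x) \<noteq> 0 \<and>
           \<phi> (proj_pt x) = proj_pt (\<chi> i. mpoly_eval (F i) x)))"

definition closed_embedding ::
  "('a::field, 'n::finite) pt set \<Rightarrow> (('a, 'n) pt \<Rightarrow> ('a, 'm::finite) pt) \<Rightarrow> bool" where
  "closed_embedding X \<phi> \<longleftrightarrow>
     is_morphism X \<phi> \<and> zariski_closed (\<phi> ` X) \<and>
     inj_on \<phi> X \<and> is_morphism (\<phi> ` X) (inv_into X \<phi>)"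

section \<open>Elliptic curves\<close>

text \<open>
  An elliptic curve is given by a general Weierstrass equation
  \<open>y\<^sup>2z + a\<^sub>1xyz + a\<^sub>3yz\<^sup>2 = x\<^sup>3 + a\<^sub>2x\<^sup>2z + a\<^sub>4xz\<^sup>2 + a\<^sub>6z\<^sup>3\<close>
  with nonzero discriminant; the quantities below are the usual ones of Tate and Silverman.
\<close>

record 'a weierstrass =
  a1 :: 'a
  a2 :: 'a
  a3 :: 'a
  a4 :: 'a
  a6 :: 'a

definition b2 :: "'a::field weierstrass \<Rightarrow> 'a" where
  "b2 W = a1 W ^ 2 + 4 * a2 W"

definition b4 :: "'a::field weierstrass \<Rightarrow> 'a" where
  "b4 W = 2 * a4 W + a1 W * a3 W"

definition b6 :: "'a::field weierstrass \<Rightarrow> 'a" where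
  "b6 W = a3 W ^ 2 + 4 * a6 W"

definition b8 :: "'a::field weierstrass \<Rightarrow> 'a" where
  "b8 W = a1 W ^ 2 * a6 W + 4 * a2 W * a6 W - a1 W * a3 W * a4 W
          + a2 W * a3 W ^ 2 - a4 W ^ 2"

definition c4 :: "'a::field weierstrass \<Rightarrow> 'a" where
  "c4 W = b2 W ^ 2 - 24 * b4 W"

definition discriminant :: "'a::field weierstrass \<Rightarrow> 'a" where
  "discriminant W = - (b2 W ^ 2 * b8 W) - 8 * b4 W ^ 3 - 27 * b6 W ^ 2 + 9 * b2 W * b4 W * b6 W"

definition is_elliptic :: "'a::field weierstrass \<Rightarrow> bool" where
  "is_elliptic W \<longleftrightarrow> discriminant W \<noteq> 0"

definition j_invariant :: "'a::field weierstrass \<Rightarrow> 'a" where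
  "j_invariant W = c4 W ^ 3 / discriminant W"

definition weierstrass_curve :: "'a::field weierstrass \<Rightarrow> ('a, 3) pt set" where
  "weierstrass_curve W = {p \<in> proj_space. \<forall>u\<in>p.
     let x = u $ 1; y = u $ 2; z = u $ 3 in
       y ^ 2 * z + a1 W * x * y * z + a3 W * y * z ^ 2 =
       x ^ 3 + a2 W * x ^ 2 * z + a4 W * x * z ^ 2 + a6 W * z ^ 3}"

section \<open>Tropicalization\<close>

text \<open>Laurent polynomials in variables indexed by \<open>'n\<close>; the exponents are integer vectors.\<close>

type_synonym ('a, 'n) laurent = "(int ^ 'n) \<Rightarrow>\<^sub>0 'a"

definition of_int_vec :: "int ^ 'n \<Rightarrow> real ^ 'n" where
  "of_int_vec w = (\<chi> i. real_of_int (w $ i))"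

definition torus :: "('a::field ^ 'n::finite) set" where
  "torus = {t. \<forall>i. t $ i \<noteq> 0}"

definition laurent_eval :: "('a::field, 'n::finite) laurent \<Rightarrow> 'a ^ 'n \<Rightarrow> 'a" where
  "laurent_eval f t =
     (\<Sum>i\<in>Poly_Mapping.keys f. Poly_Mapping.lookup f i * (\<Prod>k\<in>UNIV. (t $ k) powi (i $ k)))"

definition vanishing_ideal :: "('a::field ^ 'n::finite) set \<Rightarrow> ('a, 'n) laurent set" where
  "vanishing_ideal C = {f. \<forall>t\<in>C. laurent_eval f t = 0}"

definition trop_term ::
  "('a::field \<Rightarrow> real) \<Rightarrow> ('a, 'n::finite) laurent \<Rightarrow> real ^ 'n \<Rightarrow> int ^ 'n \<Rightarrow> real" where
  "trop_term v f w i = v (Poly_Mapping.lookup f i) + of_int_vec i \<bullet> w"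

definition trop_poly ::
  "('a::field \<Rightarrow> real) \<Rightarrow> ('a, 'n::finite) laurent \<Rightarrow> real ^ 'n \<Rightarrow> real" where
  "trop_poly v f w = Min (trop_term v f w ` Poly_Mapping.keys f)"

text \<open>For \<open>f = 0\<close> the minimum is over the empty set; by convention \<open>trop(V(0))\<close> is everything.\<close>

definition trop_hypersurface ::
  "('a::field \<Rightarrow> real) \<Rightarrow> ('a, 'n::finite) laurent \<Rightarrow> (real ^ 'n) set" where
  "trop_hypersurface v f =
     (if f = 0 then UNIV
      else {w. \<exists>i\<in>Poly_Mapping.keys f. \<exists>j\<in>Poly_Mapping.keys f. i \<noteq> j \<and>
                 trop_term v f w i = trop_poly v f w \<and> trop_term v f w j = trop_poly v f w})"

definition trop_variety ::
  "('a::field \<Rightarrow> real) \<Rightarrow> ('a, 'n::finite) laurent set \<Rightarrow> (real ^ 'n) set" where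
  "trop_variety v I = (\<Inter>f\<in>I. trop_hypersurface v f)"

text \<open>The torus \<open>(K\<^sup>*)\<^sup>2\<close> sits in \<open>P\<^sup>2\<close> as the points \<open>[x : y : 1]\<close> with \<open>x, y\<close> nonzero.\<close>

definition torus_part :: "('a::field, 3) pt set \<Rightarrow> ('a ^ 2) set" where
  "torus_part X = {t \<in> torus. proj_pt (vector [t $ 1, t $ 2, 1]) \<in> X}"

definition tropicalization ::
  "('a::field \<Rightarrow> real) \<Rightarrow> ('a, 'n::finite) pt set \<Rightarrow> (('a, 'n) pt \<Rightarrow> ('a, 3) pt) \<Rightarrow> (real ^ 2) set" where
  "tropicalization v E \<phi> = trop_variety v (vanishing_ideal (torus_part (\<phi> ` E)))"

section \<open>Graph structure, lattice length, cycles\<close>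

definition polyhedral_complex :: "'e::euclidean_space set set \<Rightarrow> bool" where
  "polyhedral_complex \<Sigma> \<longleftrightarrow>
     finite \<Sigma> \<and>
     (\<forall>P\<in>\<Sigma>. polyhedron P \<and> P \<noteq> {}) \<and>
     (\<forall>P\<in>\<Sigma>. \<forall>F. F face_of P \<longrightarrow> F \<noteq> {} \<longrightarrow> F \<in> \<Sigma>) \<and>
     (\<forall>P\<in>\<Sigma>. \<forall>Q\<in>\<Sigma>. (P \<inter> Q) face_of P \<and> (P \<inter> Q) face_of Q)"

definition rational_slope :: "(real ^ 'n::finite) set \<Rightarrow> bool" where
  "rational_slope e \<longleftrightarrow>
     (\<exists>w :: int ^ 'n. w \<noteq> 0 \<and> (\<forall>p\<in>e. \<forall>q\<in>e. \<exists>c :: real. q - p = c *\<^sub>R of_int_vec w))"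

definition edges :: "'e::euclidean_space set set \<Rightarrow> 'e set set" where
  "edges \<Sigma> = {e \<in> \<Sigma>. aff_dim e = 1}"

text \<open>
  A graph structure on \<open>T\<close>: a polyhedral complex of pure dimension one with support \<open>T\<close>
  whose edges have rational slope.
\<close>

definition graph_structure :: "(real ^ 'n::finite) set \<Rightarrow> (real ^ 'n) set set \<Rightarrow> bool" where
  "graph_structure T \<Sigma> \<longleftrightarrow>
     polyhedral_complex \<Sigma> \<and> \<Union>\<Sigma> = T \<and>
     (\<forall>P\<in>\<Sigma>. \<exists>e\<in>edges \<Sigma>. P \<subseteq> e) \<and>
     (\<forall>e\<in>edges \<Sigma>. rational_slope e)"

definition bounded_edges :: "'e::euclidean_space set set \<Rightarrow> 'e set set" where
  "bounded_edges \<Sigma> = {e \<in> edges \<Sigma>. bounded e}"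

definition primitive :: "int ^ 'n \<Rightarrow> bool" where
  "primitive w \<longleftrightarrow> Gcd {w $ i | i. True} = 1"

definition lattice_length :: "(real ^ 'n::finite) set \<Rightarrow> real" where
  "lattice_length e = (THE l. l \<ge> 0 \<and>
     (\<exists>P Q w. e = closed_segment P Q \<and> primitive w \<and> Q - P = l *\<^sub>R of_int_vec w))"

definition edge_ends :: "'e::euclidean_space set \<Rightarrow> 'e set" where
  "edge_ends e = {p. p extreme_point_of e}"

definition verts :: "'e::euclidean_space set set \<Rightarrow> 'e set" where
  "verts S = (\<Union>e\<in>S. edge_ends e)"

definition valence :: "'e::euclidean_space set set \<Rightarrow> 'e \<Rightarrow> nat" where
  "valence S p = card {e \<in> S. p \<in> edge_ends e}"

text \<open>Two vertices of the graph with edge set \<open>S\<close> are related if a path in it joins them.\<close>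

definition joined :: "'e::euclidean_space set set \<Rightarrow> ('e \<times> 'e) set" where
  "joined S = {(p, q). \<exists>e\<in>S. p \<in> edge_ends e \<and> q \<in> edge_ends e}\<^sup>* \<inter> (verts S \<times> verts S)"

definition graph_connected :: "'e::euclidean_space set set \<Rightarrow> bool" where
  "graph_connected S \<longleftrightarrow> (\<forall>p\<in>verts S. \<forall>q\<in>verts S. (p, q) \<in> joined S)"

definition betti_number :: "'e::euclidean_space set set \<Rightarrow> int" where
  "betti_number S = int (card S) - int (card (verts S)) + int (card (verts S // joined S))"

definition leafless :: "'e::euclidean_space set set \<Rightarrow> bool" where
  "leafless S \<longleftrightarrow> (\<forall>p\<in>verts S. valence S p \<noteq> 1)"

definition is_cycle :: "'e::euclidean_space set set \<Rightarrow> 'e set set \<Rightarrow> bool" where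
  "is_cycle \<Sigma> S \<longleftrightarrow>
     finite S \<and> S \<subseteq> bounded_edges \<Sigma> \<and>
     graph_connected S \<and> leafless S \<and> betti_number S = 1"

definition contains_cycle_of_length :: "(real ^ 'n::finite) set \<Rightarrow> real \<Rightarrow> bool" where
  "contains_cycle_of_length T L \<longleftrightarrow>
     (\<exists>\<Sigma> S. graph_structure T \<Sigma> \<and> is_cycle \<Sigma> S \<and> (\<Sum>e\<in>S. lattice_length e) = L)"

end

theory Submission
  imports Defs
begin

text \<open>
  The cubic \<open>y\<^sup>2 + xy + ay = x\<^sup>3\<close> has \<open>j = (1 - 24a)\<^sup>3 / (a\<^sup>3(1 - 27a))\<close>, and its Newton polygon is a
  triangle whose only lattice points are the corners and the interior point \<open>(1, 1)\<close>. For
  \<open>\<alpha> = v a > 0\<close> the tropical curve is therefore a triangle, with edges of lattice length \<open>\<alpha>\<close>,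
  together with a ray at each vertex, and \<open>v j = - 3\<alpha>\<close>. If \<open>v j < 0\<close>, the Newton polygon of the quartic
  equation for \<open>a\<close> provides such an \<open>a\<close>, and since \<open>2\<close> and \<open>3\<close> are invertible the given curve is
  carried to this cubic by a linear change of coordinates.

  That every element of the vanishing ideal tropicalizes to a set containing this tropical
  curve follows from density: tropical hypersurfaces are closed, and over a dense set of points of
  the tropical curve one coordinate of a point of the cubic can be prescribed while Newton polygons give
  the other coordinate with the right valuation.
\<close>

section \<open>Valuations\<close>

text \<open>\<open>K\<close> is not assumed complete, so neither Tate uniformization nor Hensel
  lifting is at hand. Every element of prescribed valuation comes instead from splitting a
  polynomial into linear factors over the algebraically closed field.

  The interior point (1,1) cuts the Newton triangle with corners (0,2), (0,1), (3,0) into three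
  unimodular triangles. They are dual to the three vertices, and the segments from (1,1) to the
  corners are dual to the bounded edges. In the formula for \<open>j\<close>, the factors 1 - 24a
  and 1 - 27a have valuation zero, so only a^3 contributes, with exponent equal to the number of
  these edges.

  Curves with the same \<open>j\<close> are isomorphic over an algebraically closed field. Between
  plane Weierstrass models the isomorphism is linear, and this makes it a closed embedding whose
  image is the chosen cubic.

  The vanishing ideal is never computed: a single element bounds the tropicalization from above, and
  points of the curve bound it from below.\<close>

locale valuation =
  fixes v :: "'a::alg_closed_field \<Rightarrow> real"
  assumes is_valuation: "is_valuation v"
begin

lemma v_mult: "x \<noteq> 0 \<Longrightarrow> y \<noteq> 0 \<Longrightarrow> v (x * y) = v x + v y"
  using is_valuation by (auto simp: is_valuation_def)

lemma v_add: "x \<noteq> 0 \<Longrightarrow> y \<noteq> 0 \<Longrightarrow> x + y \<noteq> 0 \<Longrightarrow> v (x + y) \<ge> min (v x) (v y)"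
  using is_valuation by (auto simp: is_valuation_def)

lemma v_1 [simp]: "v 1 = 0"
  using v_mult[of 1 1] by simp

lemma v_minus [simp]: "v (- x) = v x"
proof (cases "x = 0")
  case False
  have "v (- 1) + v (- 1) = 0"
    using v_mult[of "- 1" "- 1"] by simp
  then show ?thesis
    using v_mult[of "- 1" x] False by simp
qed simp

lemma v_power: "x \<noteq> 0 \<Longrightarrow> v (x ^ n) = n * v x"
  by (induction n) (auto simp: v_mult algebra_simps)

lemma v_inverse: "x \<noteq> 0 \<Longrightarrow> v (inverse x) = - v x"
  using v_mult[of x "inverse x"] by simp

lemma v_power_int: "x \<noteq> 0 \<Longrightarrow> v (x powi m) = m * v x"
  by (auto simp: power_int_def v_power v_inverse)

lemma v_add_less:
  assumes "x \<noteq> 0" "y = 0 \<or> v x < v y"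
  shows "x + y \<noteq> 0" "v (x + y) = v x"
proof -
  show nz: "x + y \<noteq> 0"
    using assms by (metis add_eq_0_iff v_minus less_irrefl add.right_neutral)
  show "v (x + y) = v x"
  proof (cases "y = 0")
    case False
    then show ?thesis
      using v_add[of x y] v_add[of "x + y" "- y"] assms nz by auto
  qed simp
qed

definition v_ge :: "'a \<Rightarrow> real \<Rightarrow> bool" where
  "v_ge x c \<longleftrightarrow> x = 0 \<or> v x \<ge> c"

lemma v_ge_add: "v_ge x c \<Longrightarrow> v_ge y c \<Longrightarrow> v_ge (x + y) c"
  unfolding v_ge_def using v_add[of x y] by (cases "x = 0"; cases "y = 0"; cases "x + y = 0") auto

lemma v_ge_of_nat: "v_ge (of_nat n) 0"
  by (induction n) (auto intro!: v_ge_add, auto simp: v_ge_def)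

lemma v_ge_numeral: "v_ge (numeral n) 0"
  using v_ge_of_nat[of "numeral n"] by simp

text \<open>Addition in the quotient is addition of cosets as sets, so the induction only needs the
  valuation ideal to contain 0 and to be closed under addition.\<close>

lemma add_pow_residue_field:
  "[n] \<cdot>\<^bsub>residue_field v\<^esub> \<one>\<^bsub>residue_field v\<^esub> =
     {h + of_nat n | h. h \<in> valuation_ideal v}"
proof (induction n)
  case 0
  show ?case
    by (simp add: add_pow_def nat_pow_def residue_field_def FactRing_def)
next
  case (Suc n)
  let ?I = "valuation_ideal v" and ?R = "valuation_ring v"
  have add: "x + y \<in> ?I" if "x \<in> ?I" "y \<in> ?I" for x y
    using that v_add[of x y] unfolding valuation_ideal_def
    by (cases "x = 0"; cases "y = 0"; cases "x + y = 0") auto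
  have zero: "0 \<in> ?I"
    by (simp add: valuation_ideal_def)
  have one: "\<one>\<^bsub>residue_field v\<^esub> = {h + 1 | h. h \<in> ?I}"
    by (auto simp: residue_field_def FactRing_def a_r_coset_def r_coset_def valuation_ring_def)
  have "[Suc n] \<cdot>\<^bsub>residue_field v\<^esub> \<one>\<^bsub>residue_field v\<^esub> =
      ([n] \<cdot>\<^bsub>residue_field v\<^esub> \<one>\<^bsub>residue_field v\<^esub>) <+>\<^bsub>?R\<^esub> \<one>\<^bsub>residue_field v\<^esub>"
    by (simp add: add_pow_def nat_pow_def residue_field_def FactRing_def)
  also have "\<dots> = {h + of_nat n + (k + 1) | h k. h \<in> ?I \<and> k \<in> ?I}"
    unfolding Suc.IH unfolding one set_add_def set_mult_def valuation_ring_def by auto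
  also have "\<dots> = {h + of_nat (Suc n) | h. h \<in> ?I}"
  proof (rule equalityI; rule subsetI)
    fix x assume "x \<in> {h + of_nat n + (k + 1) | h k. h \<in> ?I \<and> k \<in> ?I}"
    then obtain h k where "h \<in> ?I" "k \<in> ?I" "x = (h + k) + of_nat (Suc n)"
      by (auto simp: algebra_simps)
    then show "x \<in> {h + of_nat (Suc n) | h. h \<in> ?I}"
      using add by blast
  next
    fix x assume "x \<in> {h + of_nat (Suc n) | h. h \<in> ?I}"
    then obtain h where "h \<in> ?I" "x = h + of_nat n + (0 + 1)"
      by (auto simp: algebra_simps)
    then show "x \<in> {h + of_nat n + (k + 1) | h k. h \<in> ?I \<and> k \<in> ?I}"
      using zero by blast
  qed
  finally show ?case .
qed

text \<open>If \<open>p\<close> vanishes in the field, its coset is the ideal itself, while smaller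
  positive integers stay outside. Contrapositively, the hypotheses on the residue characteristic
  make 2 and 3 nonzero in the field.\<close>

lemma ring_char_residue_field_eqI:
  assumes "p > 0" "of_nat p = (0 :: 'a)" "\<And>n. 0 < n \<Longrightarrow> n < p \<Longrightarrow> of_nat n \<notin> valuation_ideal v"
  shows "ring_char (residue_field v) = p"
proof -
  let ?P = "\<lambda>n::nat. n > 0 \<and> [n] \<cdot>\<^bsub>residue_field v\<^esub> \<one>\<^bsub>residue_field v\<^esub> = \<zero>\<^bsub>residue_field v\<^esub>"
  have zero: "\<zero>\<^bsub>residue_field v\<^esub> = valuation_ideal v"
    by (simp add: residue_field_def FactRing_def)
  have 0: "0 \<in> valuation_ideal v"
    by (simp add: valuation_ideal_def)
  have p: "?P p"
    using assms by (simp add: add_pow_residue_field zero)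
  have "\<not> ?P n" if "n < p" for n
  proof
    assume n: "?P n"
    then have "0 + of_nat n \<in> valuation_ideal v"
      unfolding add_pow_residue_field zero using 0 by blast
    then show False
      using assms(3) n that by simp
  qed
  then have "(LEAST n. ?P n) = p"
    using p by (intro Least_equality) (auto simp: not_less[symmetric])
  then show ?thesis
    using p by (auto simp: ring_char_def)
qed

lemma two_neq_zero:
  assumes "ring_char (residue_field v) \<noteq> 2"
  shows "(2 :: 'a) \<noteq> 0"
proof
  assume 2: "(2 :: 'a) = 0"
  have "ring_char (residue_field v) = 2"
  proof (rule ring_char_residue_field_eqI)
    fix n :: nat assume "0 < n" "n < 2"
    then have "n = 1" by simp
    then show "of_nat n \<notin> valuation_ideal v"
      by (simp add: valuation_ideal_def)
  qed (use 2 in auto)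
  with assms show False ..
qed

lemma three_neq_zero:
  assumes "ring_char (residue_field v) \<noteq> 3"
  shows "(3 :: 'a) \<noteq> 0"
proof
  assume 3: "(3 :: 'a) = 0"
  have "(2 :: 'a) + 1 = 0"
    using 3 by simp
  \<comment> \<open>Both 1 and 2 = -1 have valuation zero, so neither lies in the valuation
    ideal.\<close>
  then have two: "(2 :: 'a) = - 1"
    by (simp only: eq_neg_iff_add_eq_0)
  have "ring_char (residue_field v) = 3"
  proof (rule ring_char_residue_field_eqI)
    fix n :: nat assume "0 < n" "n < 3"
    then have "n = 1 \<or> n = 2" by auto
    then have "of_nat n = (1 :: 'a) \<or> of_nat n = (- 1 :: 'a)"
      by (auto simp flip: two)
    then show "of_nat n \<notin> valuation_ideal v"
      by (auto simp: valuation_ideal_def)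
  qed (use 3 in auto)
  with assms show False ..
qed


section \<open>Newton polygons\<close>

text \<open>Equivalently, \<open>- w\<close> is not a slope of the Newton polygon of
  \<open>p\<close>.\<close>

definition dominant_coeff :: "'a poly \<Rightarrow> real \<Rightarrow> nat \<Rightarrow> bool" where
  "dominant_coeff p w n \<longleftrightarrow> coeff p n \<noteq> 0 \<and>
     (\<forall>i. i \<noteq> n \<longrightarrow> coeff p i \<noteq> 0 \<longrightarrow> v (coeff p n) + n * w < v (coeff p i) + i * w)"

text \<open>At \<open>w\<close> one term of X - r dominates: X if r = 0 or v r > w, which raises the
  dominant index by one, and -r if v r < w, which leaves it unchanged. Every other coefficient of
  the product is a sum of at most two terms strictly above the new minimum.\<close>

lemma dominant_coeff_linear_mult:
  assumes q: "dominant_coeff q w n" and r: "r \<noteq> 0 \<Longrightarrow> v r \<noteq> w"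
  shows "\<exists>m. dominant_coeff ([:- r, 1:] * q) w m"
proof -
  let ?p = "[:- r, 1:] * q"
  have coeff_0: "coeff ?p 0 = - r * coeff q 0"
    by simp
  have coeff_Suc: "coeff ?p (Suc i) = coeff q i - r * coeff q (Suc i)" for i
    by simp
  have qn: "coeff q n \<noteq> 0"
    and q_less: "\<And>i. i \<noteq> n \<Longrightarrow> coeff q i \<noteq> 0 \<Longrightarrow> v (coeff q n) + n * w < v (coeff q i) + i * w"
    using q by (auto simp: dominant_coeff_def)
  define \<mu> where "\<mu> = v (coeff q n) + n * w"
  have sub: "v (x - y) > c" if "x - y \<noteq> 0" "x \<noteq> 0 \<Longrightarrow> v x > c" "y \<noteq> 0 \<Longrightarrow> v y > c" for x y c
    using that v_add[of x "- y"] by (cases "x = 0"; cases "y = 0") auto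
  consider "r = 0 \<or> w < v r" | "r \<noteq> 0" "v r < w"
    using r by fastforce
  then show ?thesis
  proof cases
    case 1
    have lead: "coeff ?p (Suc n) \<noteq> 0 \<and> v (coeff ?p (Suc n)) = v (coeff q n)"
    proof -
      have "- (r * coeff q (Suc n)) = 0 \<or> v (coeff q n) < v (- (r * coeff q (Suc n)))"
        using 1 q_less[of "Suc n"]
        by (cases "r = 0"; cases "coeff q (Suc n) = 0") (auto simp: v_mult algebra_simps)
      from v_add_less[OF qn this] show ?thesis
        by (simp add: coeff_Suc)
    qed
    have "\<mu> + w < v (coeff ?p i) + i * w" if i: "i \<noteq> Suc n" "coeff ?p i \<noteq> 0" for i
    proof (cases i)
      case 0
      then have "r \<noteq> 0" "coeff q 0 \<noteq> 0"
        using i by auto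
      moreover from this have "\<mu> \<le> v (coeff q 0)"
        using q_less[of 0] by (cases "n = 0") (auto simp: \<mu>_def)
      ultimately show ?thesis
        using 1 0 by (simp add: v_mult)
    next
      case (Suc k)
      \<comment> \<open>The first term is strictly above the minimum because k \<noteq> n; for the
        second, a tie at \<open>Suc k = n\<close> is broken by v r > w.\<close>
      have "v (coeff q k - r * coeff q (Suc k)) > \<mu> - k * w"
      proof (rule sub)
        show "coeff q k - r * coeff q (Suc k) \<noteq> 0"
          using i Suc coeff_Suc by metis
        show "v (coeff q k) > \<mu> - k * w" if "coeff q k \<noteq> 0"
          using q_less[of k] that i Suc by (auto simp: \<mu>_def)
        show "v (r * coeff q (Suc k)) > \<mu> - k * w" if "r * coeff q (Suc k) \<noteq> 0"
        proof -
          have "\<mu> \<le> v (coeff q (Suc k)) + Suc k * w"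
            using q_less[of "Suc k"] that by (cases "Suc k = n") (auto simp: \<mu>_def)
          then show ?thesis
            using that 1 by (auto simp: v_mult algebra_simps)
        qed
      qed
      then show ?thesis
        by (simp only: Suc coeff_Suc) (simp add: algebra_simps)
    qed
    then have "dominant_coeff ?p w (Suc n)"
      unfolding dominant_coeff_def using lead by (simp add: \<mu>_def algebra_simps)
    then show ?thesis ..
  next
    case 2
    have lead: "coeff ?p n \<noteq> 0 \<and> v (coeff ?p n) = v r + v (coeff q n)"
    proof (cases n)
      case 0
      then show ?thesis
        using 2 qn by (auto simp: v_mult)
    next
      case (Suc k)
      have "coeff q k = 0 \<or> v (- r * coeff q n) < v (coeff q k)"
        using 2 qn q_less[of k] Suc by (cases "coeff q k = 0") (auto simp: v_mult algebra_simps)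
      with v_add_less[of "- r * coeff q n" "coeff q k"] show ?thesis
        using 2 qn by (simp add: Suc coeff_Suc v_mult)
    qed
    have "v r + \<mu> < v (coeff ?p i) + i * w" if i: "i \<noteq> n" "coeff ?p i \<noteq> 0" for i
    proof (cases i)
      case 0
      then have "coeff q 0 \<noteq> 0"
        using i by auto
      then show ?thesis
        using 2 0 q_less[of 0] i by (simp add: v_mult \<mu>_def)
    next
      case (Suc k)
      \<comment> \<open>The roles are exchanged: \<open>Suc k\<close> differs from \<open>n\<close>,
        and a tie at k = n is broken by v r < w.\<close>
      have "v (coeff q k - r * coeff q (Suc k)) > v r + \<mu> - Suc k * w"
      proof (rule sub)
        show "coeff q k - r * coeff q (Suc k) \<noteq> 0"
          using i Suc coeff_Suc by metis
        show "v (r * coeff q (Suc k)) > v r + \<mu> - Suc k * w" if "r * coeff q (Suc k) \<noteq> 0"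
          using q_less[of "Suc k"] that i Suc 2 by (auto simp: \<mu>_def v_mult)
        show "v (coeff q k) > v r + \<mu> - Suc k * w" if "coeff q k \<noteq> 0"
        proof -
          have "\<mu> \<le> v (coeff q k) + k * w"
            using q_less[of k] that by (cases "k = n") (auto simp: \<mu>_def)
          then show ?thesis
            using 2 by (auto simp: algebra_simps)
        qed
      qed
      then show ?thesis
        by (simp only: Suc coeff_Suc)
    qed
    then have "dominant_coeff ?p w n"
      unfolding dominant_coeff_def using lead by (simp add: \<mu>_def algebra_simps)
    then show ?thesis ..
  qed
qed

text \<open>
  If no root has valuation \<open>w\<close>, every linear factor has a single dominant term at \<open>w\<close>, and this
  property is inherited by products.
\<close>

lemma dominant_coeff_exists:
  assumes "p \<noteq> 0" "\<And>r. r \<noteq> 0 \<Longrightarrow> poly p r = 0 \<Longrightarrow> v r \<noteq> w"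
  shows "\<exists>n. dominant_coeff p w n"
  using assms
proof (induction "degree p" arbitrary: p)
  case 0
  then have "coeff p 0 \<noteq> 0" "\<And>i. i \<noteq> 0 \<Longrightarrow> coeff p i = 0"
    by (metis leading_coeff_neq_0, simp add: coeff_eq_0)
  then have "dominant_coeff p w 0"
    by (auto simp: dominant_coeff_def)
  then show ?case ..
next
  case (Suc d)
  then obtain r where "poly p r = 0"
    using alg_closed_imp_poly_has_root[of p] by auto
  then obtain q where p: "p = [:- r, 1:] * q"
    by (metis poly_eq_0_iff_dvd dvdE)
  have "q \<noteq> 0"
    using Suc.prems p by auto
  then have "degree p = Suc (degree q)"
    unfolding p by (subst degree_mult_eq) auto
  then have "d = degree q"
    using Suc.hyps by simp
  moreover have "v s \<noteq> w" if "s \<noteq> 0" "poly q s = 0" for s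
    using Suc.prems(2)[of s] that p by simp
  ultimately obtain n where "dominant_coeff q w n"
    using Suc.hyps(1) \<open>q \<noteq> 0\<close> by blast
  moreover have "r \<noteq> 0 \<Longrightarrow> v r \<noteq> w"
    using Suc.prems(2) \<open>poly p r = 0\<close> by blast
  ultimately show ?case
    unfolding p by (rule dominant_coeff_linear_mult)
qed

text \<open>Two terms tie for the minimum, so no coefficient is dominant and
  \<open>dominant_coeff_exists\<close> forces a root. The lower bound is asked only up to the
  degree, which leaves finitely many checks for an explicit polynomial.\<close>

lemma newton_polygon_root:
  fixes w \<mu> :: real
  assumes "i \<noteq> j" "coeff p i \<noteq> 0" "coeff p j \<noteq> 0"
    and "v (coeff p i) + i * w = \<mu>" "v (coeff p j) + j * w = \<mu>"
    and "\<And>k. k \<le> degree p \<Longrightarrow> coeff p k \<noteq> 0 \<Longrightarrow> \<mu> \<le> v (coeff p k) + k * w"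
  obtains r where "r \<noteq> 0" "poly p r = 0" "v r = w"
proof (rule ccontr)
  assume "\<not> thesis"
  then have no_root: "\<And>r. r \<noteq> 0 \<Longrightarrow> poly p r = 0 \<Longrightarrow> v r \<noteq> w"
    using that by blast
  have "p \<noteq> 0"
    using assms(2) by auto
  then obtain n where n: "dominant_coeff p w n"
    using dominant_coeff_exists[of p w] no_root by blast
  have "\<mu> \<le> v (coeff p n) + n * w"
    using n assms(6)[of n] by (auto simp: dominant_coeff_def le_degree)
  then show False
    using n assms(1-5) unfolding dominant_coeff_def by (metis not_less)
qed

end


section \<open>Polynomials and linear maps of projective space\<close>

lemma mpoly_eval_superset:
  assumes "finite S" "Poly_Mapping.keys F \<subseteq> S"
  shows "mpoly_eval F x =
    (\<Sum>m\<in>S. Poly_Mapping.lookup F m * (\<Prod>i\<in>UNIV. (x $ i) ^ (m $ i)))"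
  unfolding mpoly_eval_def
  by (rule sum.mono_neutral_left) (use assms in \<open>auto simp: in_keys_iff\<close>)

lemma mpoly_eval_add: "mpoly_eval (F + G) x = mpoly_eval F x + mpoly_eval G x"
proof -
  let ?S = "Poly_Mapping.keys F \<union> Poly_Mapping.keys G"
  have "Poly_Mapping.keys (F + G) \<subseteq> ?S"
    by (rule keys_add)
  then show ?thesis
    by (subst (1 2 3) mpoly_eval_superset[of ?S])
      (auto simp: lookup_add algebra_simps sum.distrib)
qed

lemma mpoly_eval_zero [simp]: "mpoly_eval 0 x = 0"
  by (simp add: mpoly_eval_def)

lemma mpoly_eval_single:
  "mpoly_eval (Poly_Mapping.single m c) x = c * (\<Prod>i\<in>UNIV. (x $ i) ^ (m $ i))"
  by (subst mpoly_eval_superset[of "{m}"]) auto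

lemma mpoly_eval_sum: "mpoly_eval (sum F A) x = (\<Sum>a\<in>A. mpoly_eval (F a) x)"
  by (induction A rule: infinite_finite_induct) (auto simp: mpoly_eval_add)

lemma homogeneous_add: "homogeneous d F \<Longrightarrow> homogeneous d G \<Longrightarrow> homogeneous d (F + G)"
  unfolding homogeneous_def using keys_add[of F G] by blast

lemma homogeneous_sum: "(\<And>a. a \<in> A \<Longrightarrow> homogeneous d (F a)) \<Longrightarrow> homogeneous d (sum F A)"
  by (induction A rule: infinite_finite_induct) (auto simp: homogeneous_add, auto simp: homogeneous_def)

lemma homogeneous_single: "(\<Sum>i\<in>UNIV. m $ i) = d \<Longrightarrow> homogeneous d (Poly_Mapping.single m c)"
  by (auto simp: homogeneous_def)

section \<open>Linear forms and linear embeddings\<close>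

definition linear_form :: "'a::field ^ 'n::finite \<Rightarrow> ('a, 'n) mpoly" where
  "linear_form c = (\<Sum>j\<in>UNIV. Poly_Mapping.single (axis j 1) (c $ j))"

lemma homogeneous_linear_form: "homogeneous (Suc 0) (linear_form c)"
  unfolding linear_form_def
  by (intro homogeneous_sum homogeneous_single) (simp add: axis_def if_distrib)

lemma mpoly_eval_linear_form: "mpoly_eval (linear_form c) x = (\<Sum>j\<in>UNIV. c $ j * x $ j)"
proof -
  have "(\<Prod>i\<in>UNIV. (x $ i) ^ (axis j 1 $ i)) = x $ j" for j
  proof -
    have "(\<Prod>i\<in>UNIV. (x $ i) ^ (axis j 1 $ i)) = (\<Prod>i\<in>UNIV. if i = j then x $ i else 1)"
      by (intro prod.cong) (auto simp: axis_def)
    then show ?thesis by simp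
  qed
  then show ?thesis
    by (simp add: linear_form_def mpoly_eval_sum mpoly_eval_single)
qed

lemma vec_mem_proj_pt: "x \<in> proj_pt x"
  unfolding proj_pt_def by (auto intro!: exI[of _ 1])

text \<open>A linear map is given by a single tuple of forms on the whole variety, so its
  exceptional set \<open>Z\<close> is empty. The constant 1 cuts it out because projective points
  are nonempty sets of coordinate vectors.\<close>

lemma zariski_closed_empty: "zariski_closed ({} :: ('a::field, 'n::finite) pt set)"
proof -
  define F :: "('a, 'n) mpoly" where "F = Poly_Mapping.single 0 1"
  have "homogeneous 0 F"
    unfolding F_def by (rule homogeneous_single) simp
  moreover have "mpoly_eval F x = 1" for x
    unfolding F_def mpoly_eval_single by simp
  moreover have "p \<noteq> {}" if "p \<in> proj_space" for p :: "('a, 'n) pt"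
    using that vec_mem_proj_pt unfolding proj_space_def by blast
  ultimately show ?thesis
    unfolding zariski_closed_def by (intro exI[of _ "{F}"]) auto
qed

lemma matrix_vector_mult_scale: "A *v (c *s x) = c *s (A *v x)"
  for A :: "'a::field ^ 'n::finite ^ 'm::finite"
  by (simp add: vec_eq_iff matrix_vector_mult_def sum_distrib_left mult_ac)

lemma image_proj_pt: "(*v) A ` proj_pt x = proj_pt (A *v x)"
  for A :: "'a::field ^ 'n::finite ^ 'm::finite"
  unfolding proj_pt_def by (auto simp: matrix_vector_mult_scale image_iff) (metis matrix_vector_mult_scale)

lemma matrix_inverse_vector:
  fixes A :: "'a::field ^ 'n::finite ^ 'm::finite"
  assumes "B ** A = mat 1"
  shows "B *v (A *v x) = x"
  by (simp add: matrix_vector_mul_assoc assms)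

text \<open>The left inverse \<open>B\<close> keeps the linear forms from having a common zero. The
  formula for \<phi> is required on \<open>X\<close> only, so that the lemma also covers
  \<open>inv_into\<close> on the image.\<close>

lemma is_morphism_linear:
  fixes A :: "'a::field ^ 'n::finite ^ 'm::finite"
  assumes "B ** A = mat 1" and "\<And>p. p \<in> X \<Longrightarrow> \<phi> p = (*v) A ` p"
  shows "is_morphism X \<phi>"
proof -
  let ?F = "\<lambda>i. linear_form (A $ i)"
  have F: "(\<chi> i. mpoly_eval (?F i) x) = A *v x" for x
    by (simp add: vec_eq_iff mpoly_eval_linear_form matrix_vector_mult_def)
  have "A *v x \<noteq> 0" if "x \<noteq> 0" for x
    using matrix_inverse_vector[OF assms(1), of x] that by (metis matrix_vector_mult_0_right)
  then have "\<exists>Z d (F :: 'm \<Rightarrow> ('a, 'n) mpoly).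
        zariski_closed Z \<and> p \<notin> Z \<and> (\<forall>i. homogeneous d (F i)) \<and>
        (\<forall>x. x \<noteq> 0 \<longrightarrow> proj_pt x \<in> X - Z \<longrightarrow>
           (\<chi> i. mpoly_eval (F i) x) \<noteq> 0 \<and>
           \<phi> (proj_pt x) = proj_pt (\<chi> i. mpoly_eval (F i) x))" for p
    using assms(2)
    by (intro exI[of _ "{}"] exI[of _ "Suc 0"] exI[of _ ?F])
      (auto simp: F zariski_closed_empty image_proj_pt intro: homogeneous_linear_form)
  then show ?thesis
    unfolding is_morphism_def by blast
qed

lemma closed_embedding_linear:
  fixes A :: "'a::field ^ 'n::finite ^ 'm::finite"
  assumes "A ** B = mat 1" "B ** A = mat 1" and "zariski_closed ((`) ((*v) A) ` X)"
  shows "closed_embedding X ((`) ((*v) A))"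
proof -
  have inv: "(*v) B ` (*v) A ` p = p" for p
    by (simp add: image_image matrix_inverse_vector assms)
  then have inj: "inj_on ((`) ((*v) A)) X"
    by (metis inj_onI)
  have "inv_into X ((`) ((*v) A)) q = (*v) B ` q" if "q \<in> (`) ((*v) A) ` X" for q
  proof -
    from that obtain p where "p \<in> X" "q = (*v) A ` p" by blast
    then show ?thesis
      by (simp only: inv_into_f_f[OF inj] inv)
  qed
  then show ?thesis
    unfolding closed_embedding_def
    using assms inj is_morphism_linear[OF assms(2), of X] is_morphism_linear[OF assms(1)] by blast
qed


section \<open>Changes of Weierstrass coordinates\<close>

definition weierstrass_form :: "'a::field weierstrass \<Rightarrow> 'a ^ 3 \<Rightarrow> 'a" where
  "weierstrass_form W u =
     u $ 2 ^ 2 * u $ 3 + a1 W * u $ 1 * u $ 2 * u $ 3 + a3 W * u $ 2 * u $ 3 ^ 2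
     - (u $ 1 ^ 3 + a2 W * u $ 1 ^ 2 * u $ 3 + a4 W * u $ 1 * u $ 3 ^ 2 + a6 W * u $ 3 ^ 3)"

lemma weierstrass_curve_altdef:
  "weierstrass_curve W = {p \<in> proj_space. \<forall>u\<in>p. weierstrass_form W u = 0}"
  by (simp add: weierstrass_curve_def weierstrass_form_def Let_def)

lemma weierstrass_form_scale: "weierstrass_form W (c *s x) = c ^ 3 * weierstrass_form W x"
  by (simp add: weierstrass_form_def power_mult_distrib power2_eq_square power3_eq_cube algebra_simps)

lemma proj_pt_mem_weierstrass_curve:
  assumes "x \<noteq> 0"
  shows "proj_pt x \<in> weierstrass_curve W \<longleftrightarrow> weierstrass_form W x = 0"
proof -
  have "proj_pt x \<in> proj_space"
    using assms by (simp add: proj_space_def)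
  then show ?thesis
    unfolding weierstrass_curve_altdef
    using vec_mem_proj_pt[of x] by (auto simp: proj_pt_def weierstrass_form_scale)
qed

lemma mpoly_eval_single_3:
  fixes x :: "'a::field ^ 3"
  shows "mpoly_eval (Poly_Mapping.single m c) x = c * (x $ 1 ^ (m $ 1) * x $ 2 ^ (m $ 2) * x $ 3 ^ (m $ 3))"
  unfolding mpoly_eval_single UNIV_3 by (simp add: mult.assoc)

definition weierstrass_mpoly :: "'a::field weierstrass \<Rightarrow> ('a, 3) mpoly" where
  "weierstrass_mpoly W =
     Poly_Mapping.single (vector [0, 2, 1]) 1 + Poly_Mapping.single (vector [1, 1, 1]) (a1 W)
     + Poly_Mapping.single (vector [0, 1, 2]) (a3 W) + Poly_Mapping.single (vector [3, 0, 0]) (- 1)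
     + Poly_Mapping.single (vector [2, 0, 1]) (- a2 W) + Poly_Mapping.single (vector [1, 0, 2]) (- a4 W)
     + Poly_Mapping.single (vector [0, 0, 3]) (- a6 W)"

lemma mpoly_eval_weierstrass_mpoly: "mpoly_eval (weierstrass_mpoly W) x = weierstrass_form W x"
  unfolding weierstrass_mpoly_def weierstrass_form_def mpoly_eval_add mpoly_eval_single_3 vector_3
  by simp

lemma homogeneous_weierstrass_mpoly: "homogeneous 3 (weierstrass_mpoly W)"
  unfolding weierstrass_mpoly_def
  by (intro homogeneous_add homogeneous_single) (simp_all add: sum_3)

lemma zariski_closed_weierstrass_curve: "zariski_closed (weierstrass_curve W)"
  unfolding zariski_closed_def weierstrass_curve_altdef
  using homogeneous_weierstrass_mpoly
  by (intro exI[of _ "{weierstrass_mpoly W}"]) (auto simp: mpoly_eval_weierstrass_mpoly)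

text \<open>Comparing zero sets rather than forms allows a scalar factor in the equation, such as
  \<open>u ^ 6\<close> in the rescaling below.\<close>

definition linearly_equivalent :: "'a::field weierstrass \<Rightarrow> 'a weierstrass \<Rightarrow> bool" where
  "linearly_equivalent W W' \<longleftrightarrow> (\<exists>A B. A ** B = mat 1 \<and> B ** A = mat 1 \<and>
     (\<forall>x. weierstrass_form W' (A *v x) = 0 \<longleftrightarrow> weierstrass_form W x = 0))"

lemma linearly_equivalent_sym:
  assumes "linearly_equivalent W W'"
  shows "linearly_equivalent W' W"
proof -
  obtain A B where AB: "A ** B = mat 1" "B ** A = mat 1"
    and "\<And>x. weierstrass_form W' (A *v x) = 0 \<longleftrightarrow> weierstrass_form W x = 0"
    using assms unfolding linearly_equivalent_def by blast
  then have "weierstrass_form W (B *v x) = 0 \<longleftrightarrow> weierstrass_form W' x = 0" for x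
    by (metis matrix_inverse_vector)
  with AB show ?thesis
    unfolding linearly_equivalent_def by blast
qed

lemma linearly_equivalent_trans:
  assumes "linearly_equivalent W W'" "linearly_equivalent W' W''"
  shows "linearly_equivalent W W''"
proof -
  obtain A B where AB: "A ** B = mat 1" "B ** A = mat 1"
    and A: "\<And>x. weierstrass_form W' (A *v x) = 0 \<longleftrightarrow> weierstrass_form W x = 0"
    using assms unfolding linearly_equivalent_def by blast
  obtain C D where CD: "C ** D = mat 1" "D ** C = mat 1"
    and C: "\<And>x. weierstrass_form W'' (C *v x) = 0 \<longleftrightarrow> weierstrass_form W' x = 0"
    using assms unfolding linearly_equivalent_def by blast
  have "(C ** A) ** (B ** D) = mat 1" "(B ** D) ** (C ** A) = mat 1"
    by (metis AB CD matrix_mul_assoc matrix_mul_rid)+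
  moreover have "weierstrass_form W'' ((C ** A) *v x) = 0 \<longleftrightarrow> weierstrass_form W x = 0" for x
    by (simp add: A C flip: matrix_vector_mul_assoc)
  ultimately show ?thesis
    unfolding linearly_equivalent_def by blast
qed

lemma linearly_equivalent_imp_closed_embedding:
  assumes "linearly_equivalent W W'"
  obtains \<phi> where "closed_embedding (weierstrass_curve W) \<phi>"
    and "\<phi> ` weierstrass_curve W = weierstrass_curve W'"
proof -
  obtain A B where AB: "A ** B = mat 1" "B ** A = mat 1"
    and A: "\<And>x. weierstrass_form W' (A *v x) = 0 \<longleftrightarrow> weierstrass_form W x = 0"
    using assms unfolding linearly_equivalent_def by blast
  have nz: "A *v x \<noteq> 0" "B *v x \<noteq> 0" if "x \<noteq> 0" for x
    using that AB by (metis matrix_inverse_vector matrix_vector_mult_0_right)+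
  have "(`) ((*v) A) ` weierstrass_curve W = weierstrass_curve W'"
  proof (rule equalityI; rule subsetI)
    fix q assume "q \<in> (`) ((*v) A) ` weierstrass_curve W"
    then obtain x where "x \<noteq> 0" "proj_pt x \<in> weierstrass_curve W" "q = (*v) A ` proj_pt x"
      by (auto simp: weierstrass_curve_altdef proj_space_def)
    then show "q \<in> weierstrass_curve W'"
      using A nz by (simp add: image_proj_pt proj_pt_mem_weierstrass_curve)
  next
    fix q assume "q \<in> weierstrass_curve W'"
    then obtain y where y: "y \<noteq> 0" "proj_pt y \<in> weierstrass_curve W'" "q = proj_pt y"
      by (auto simp: weierstrass_curve_altdef proj_space_def)
    then have "proj_pt (B *v y) \<in> weierstrass_curve W"
      using A[of "B *v y"] nz
      by (simp add: proj_pt_mem_weierstrass_curve matrix_inverse_vector[OF AB(1)])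
    moreover have "q = (*v) A ` proj_pt (B *v y)"
      by (simp add: y image_proj_pt matrix_inverse_vector[OF AB(1)])
    ultimately show "q \<in> (`) ((*v) A) ` weierstrass_curve W"
      by blast
  qed
  moreover from this have "closed_embedding (weierstrass_curve W) ((`) ((*v) A))"
    by (intro closed_embedding_linear[OF AB]) (simp add: zariski_closed_weierstrass_curve)
  ultimately show thesis
    using that by blast
qed

text \<open>This is the standard substitution x = x' + r, y = y' + s x' + t. The transformation
  formulas are solved for the coefficients of \<open>W\<close> one after another, so that they can
  be unfolded.\<close>

lemma linearly_equivalent_translate:
  fixes W W' :: "'a::field weierstrass"
  assumes "a1 W = a1 W' - 2 * s"
    and "a2 W = a2 W' + s * a1 W - 3 * r + s ^ 2"
    and "a3 W = a3 W' - r * a1 W - 2 * t"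
    and "a4 W = a4 W' + s * a3 W - 2 * r * a2 W + (t + r * s) * a1 W - 3 * r ^ 2 + 2 * s * t"
    and "a6 W = a6 W' - r * a4 W - r ^ 2 * a2 W - r ^ 3 + t * a3 W + t ^ 2 + r * t * a1 W"
  shows "linearly_equivalent W' W"
proof -
  define A :: "'a ^ 3 ^ 3" where
    "A = vector [vector [1, 0, r], vector [s, 1, t], vector [0, 0, 1]]"
  define B :: "'a ^ 3 ^ 3" where
    "B = vector [vector [1, 0, - r], vector [- s, 1, s * r - t], vector [0, 0, 1]]"
  have "A ** B = mat 1" "B ** A = mat 1"
    by (simp_all add: A_def B_def vec_eq_iff forall_3 matrix_matrix_mult_def sum_3 mat_def)
  moreover have "weierstrass_form W (A *v x) = weierstrass_form W' x" for x
  proof -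
    have Ax: "(A *v x) $ 1 = x $ 1 + r * x $ 3"
      "(A *v x) $ 2 = s * x $ 1 + x $ 2 + t * x $ 3"
      "(A *v x) $ 3 = x $ 3"
      by (simp_all add: A_def matrix_vector_mult_def sum_3)
    show ?thesis
      unfolding weierstrass_form_def assms Ax by Groebner_Basis.algebra
  qed
  ultimately show ?thesis
    unfolding linearly_equivalent_def
    by (intro exI[of _ A] exI[of _ B]) auto
qed

section \<open>Short Weierstrass form and classification by the j-invariant\<close>

definition c6 :: "'a::field weierstrass \<Rightarrow> 'a" where
  "c6 W = - (b2 W ^ 3) + 36 * b2 W * b4 W - 216 * b6 W"

lemma c4_c6_discriminant:
  "1728 * discriminant W = c4 W ^ 3 - c6 W ^ 2"
  unfolding discriminant_def c4_def c6_def b2_def b4_def b6_def b8_def by Groebner_Basis.algebra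

definition short_weierstrass :: "'a::field \<Rightarrow> 'a \<Rightarrow> 'a weierstrass" where
  "short_weierstrass A B = \<lparr>a1 = 0, a2 = 0, a3 = 0, a4 = A, a6 = B\<rparr>"

text \<open>
  Completing the square and the cube; \<open>\<alpha>\<close>, \<open>\<beta>\<close>, \<open>\<rho>\<close> clear the denominators from the coefficients.
\<close>

lemma linearly_equivalent_short:
  fixes W :: "'a::field weierstrass"
  assumes "(2 :: 'a) \<noteq> 0" "(3 :: 'a) \<noteq> 0"
  shows "linearly_equivalent (short_weierstrass (- c4 W / 48) (- c6 W / 864)) W"
proof -
  define \<alpha> where "\<alpha> = a1 W / 2"
  define \<beta> where "\<beta> = a3 W / 2"
  define \<rho> where "\<rho> = (a2 W + \<alpha> ^ 2) / 3"
  have "3 * \<rho> = a2 W + \<alpha> ^ 2"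
    using assms by (simp add: \<rho>_def)
  then have a: "a1 W = 2 * \<alpha>" "a3 W = 2 * \<beta>" "a2 W = 3 * \<rho> - \<alpha> ^ 2"
    using assms by (simp_all add: \<alpha>_def \<beta>_def)
  have "(48 :: 'a) = 2 ^ 4 * 3" "(864 :: 'a) = 2 ^ 5 * 3 ^ 3"
    by simp_all
  then have nz: "(48 :: 'a) \<noteq> 0" "(864 :: 'a) \<noteq> 0"
    using assms by (metis mult_eq_0_iff power_not_zero)+
  have "c4 W = 48 * (3 * \<rho> ^ 2 - a4 W - 2 * \<alpha> * \<beta>)"
    unfolding c4_def b2_def b4_def a by Groebner_Basis.algebra
  then have A: "- c4 W / 48 = a4 W + 2 * \<alpha> * \<beta> - 3 * \<rho> ^ 2"
    using nz by (simp add: field_simps)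
  have "c6 W = 864 * (\<rho> * (a4 W + 2 * \<alpha> * \<beta>) - 2 * \<rho> ^ 3 - \<beta> ^ 2 - a6 W)"
    unfolding c6_def b2_def b4_def b6_def a by Groebner_Basis.algebra
  then have B: "- c6 W / 864 = a6 W + \<beta> ^ 2 + 2 * \<rho> ^ 3 - \<rho> * (a4 W + 2 * \<alpha> * \<beta>)"
    using nz by (simp add: field_simps)
  show ?thesis
    unfolding A B short_weierstrass_def
    \<comment> \<open>Inverting the substitution gives x' = x + \<rho> and y' = y + \<alpha> x +
      \<beta>, which complete the cube and the square; \<open>t\<close> absorbs the shift of x
      inside \<alpha> x.\<close>
    by (rule linearly_equivalent_translate[where s = "- \<alpha>" and r = "- \<rho>" and t = "\<rho> * \<alpha> - \<beta>"])
      (simp_all add: a algebra_simps power2_eq_square power3_eq_cube)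
qed

lemma linearly_equivalent_short_scale:
  fixes u :: "'a::field"
  assumes "u \<noteq> 0"
  shows "linearly_equivalent (short_weierstrass A B) (short_weierstrass (u ^ 4 * A) (u ^ 6 * B))"
proof -
  define M :: "'a ^ 3 ^ 3" where
    "M = vector [vector [u ^ 2, 0, 0], vector [0, u ^ 3, 0], vector [0, 0, 1]]"
  define N :: "'a ^ 3 ^ 3" where
    "N = vector [vector [1 / u ^ 2, 0, 0], vector [0, 1 / u ^ 3, 0], vector [0, 0, 1]]"
  have "M ** N = mat 1" "N ** M = mat 1"
    using assms
    by (simp_all add: M_def N_def vec_eq_iff forall_3 matrix_matrix_mult_def sum_3 mat_def)
  moreover have "weierstrass_form (short_weierstrass (u ^ 4 * A) (u ^ 6 * B)) (M *v x) =
      u ^ 6 * weierstrass_form (short_weierstrass A B) x" for x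
  proof -
    have Mx: "(M *v x) $ 1 = u ^ 2 * x $ 1" "(M *v x) $ 2 = u ^ 3 * x $ 2" "(M *v x) $ 3 = x $ 3"
      by (simp_all add: M_def matrix_vector_mult_def sum_3)
    show ?thesis
      unfolding weierstrass_form_def short_weierstrass_def weierstrass.simps Mx
      by Groebner_Basis.algebra
  qed
  ultimately show ?thesis
    unfolding linearly_equivalent_def using assms
    by (intro exI[of _ M] exI[of _ N]) auto
qed

text \<open>By \<open>c4_c6_discriminant\<close>, equal \<open>j\<close> means that c4^3 and c6^2
  are in the same ratio for both curves, and this makes the two conditions on the scaling
  \<open>u\<close> compatible. The values 0 and 1728 are excluded since c4 or c6 vanishes
  there.\<close>

lemma linearly_equivalent_if_j_invariant_eq:
  fixes W W' :: "'a::alg_closed_field weierstrass"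
  assumes char: "(2 :: 'a) \<noteq> 0" "(3 :: 'a) \<noteq> 0"
    and ell: "is_elliptic W" "is_elliptic W'"
    and j: "j_invariant W = j_invariant W'" "j_invariant W \<noteq> 0" "j_invariant W \<noteq> 1728"
  shows "linearly_equivalent W W'"
proof -
  have \<Delta>: "discriminant W \<noteq> 0" "discriminant W' \<noteq> 0"
    using ell by (simp_all add: is_elliptic_def)
  have c4: "c4 W \<noteq> 0" "c4 W' \<noteq> 0"
    using j by (auto simp: j_invariant_def)
  have c6_iff: "c6 V = 0 \<longleftrightarrow> j_invariant V = 1728" if "discriminant V \<noteq> 0" for V :: "'a weierstrass"
    using c4_c6_discriminant[of V] that by (auto simp: j_invariant_def divide_eq_eq)
  have c6: "c6 W \<noteq> 0" "c6 W' \<noteq> 0"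
    using c6_iff[of W] c6_iff[of W'] \<Delta> j by auto
  have cross: "c4 W ^ 3 * discriminant W' = c4 W' ^ 3 * discriminant W"
    using j(1) \<Delta> by (simp add: j_invariant_def frac_eq_eq)
  have c6_sq: "c6 V ^ 2 = c4 V ^ 3 - 1728 * discriminant V" for V :: "'a weierstrass"
    by (simp add: c4_c6_discriminant)
  \<comment> \<open>After substituting for c6^2 the products of the cubes cancel, and 1728 times
    \<open>cross\<close> remains.\<close>
  have c6_c4: "c6 W ^ 2 * c4 W' ^ 3 = c6 W' ^ 2 * c4 W ^ 3"
    unfolding c6_sq using cross by (auto simp: algebra_simps)
  \<comment> \<open>the scaling must satisfy \<open>u\<^sup>4 = c4 W' / c4 W\<close> and \<open>u\<^sup>6 = c6 W' / c6 W\<close>, so \<open>u\<^sup>2\<close> is their quotient\<close>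
  obtain u where u: "u ^ 2 = c6 W' * c4 W / (c6 W * c4 W')"
    using nth_root_exists[of 2] by (metis zero_less_numeral)
  then have "u \<noteq> 0"
    using c4 c6 by auto
  have "u ^ 4 = (u ^ 2) ^ 2"
    by simp
  also have "\<dots> * c4 W = c4 W'"
    unfolding u using c4 c6 c6_c4 by (simp add: field_simps power2_eq_square power3_eq_cube)
  finally have u4: "u ^ 4 * c4 W = c4 W'" .
  then have u4': "u ^ 4 = c4 W' / c4 W"
    using c4 by (simp add: field_simps)
  have "u ^ 6 * c6 W = u ^ 2 * u ^ 4 * c6 W"
    by (simp flip: power_add)
  also have "\<dots> = c6 W'"
    unfolding u u4' using c4 c6 by simp
  finally have u6: "u ^ 6 * c6 W = c6 W'" .
  have "linearly_equivalent (short_weierstrass (- c4 W / 48) (- c6 W / 864))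
      (short_weierstrass (- c4 W' / 48) (- c6 W' / 864))"
    using linearly_equivalent_short_scale[OF \<open>u \<noteq> 0\<close>, of "- c4 W / 48" "- c6 W / 864"]
    by (simp flip: u4 u6)
  from linearly_equivalent_trans[OF this linearly_equivalent_short[OF char]]
  show ?thesis
    by (rule linearly_equivalent_trans[OF linearly_equivalent_sym[OF linearly_equivalent_short[OF char]]])
qed


section \<open>Tropicalization and points of a curve\<close>

lemma laurent_eval_superset:
  assumes "finite S" "Poly_Mapping.keys f \<subseteq> S"
  shows "laurent_eval f t =
    (\<Sum>i\<in>S. Poly_Mapping.lookup f i * (\<Prod>k\<in>UNIV. (t $ k) powi (i $ k)))"
  unfolding laurent_eval_def
  by (rule sum.mono_neutral_left) (use assms in \<open>auto simp: in_keys_iff\<close>)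

lemma laurent_eval_add: "laurent_eval (f + g) t = laurent_eval f t + laurent_eval g t"
proof -
  let ?S = "Poly_Mapping.keys f \<union> Poly_Mapping.keys g"
  have "Poly_Mapping.keys (f + g) \<subseteq> ?S"
    by (rule keys_add)
  then show ?thesis
    by (subst (1 2 3) laurent_eval_superset[of ?S])
      (auto simp: lookup_add algebra_simps sum.distrib)
qed

lemma laurent_eval_single:
  "laurent_eval (Poly_Mapping.single m c) t = c * (\<Prod>k\<in>UNIV. (t $ k) powi (m $ k))"
  by (subst laurent_eval_superset[of "{m}"]) auto

text \<open>A tie for the minimum is a finite system of weak inequalities between continuous
  functions, and there are finitely many pairs of exponents that can tie.\<close>

lemma closed_trop_hypersurface: "closed (trop_hypersurface v f)"
proof (cases "f = 0")
  case False
  let ?K = "Poly_Mapping.keys f" and ?T = "trop_term v f"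
  have min_iff: "?T w i = trop_poly v f w \<longleftrightarrow> (\<forall>k\<in>?K. ?T w i \<le> ?T w k)" if "i \<in> ?K" for w i
  proof
    show "\<forall>k\<in>?K. ?T w i \<le> ?T w k" if "?T w i = trop_poly v f w"
      using that by (simp add: trop_poly_def)
    show "?T w i = trop_poly v f w" if "\<forall>k\<in>?K. ?T w i \<le> ?T w k"
      unfolding trop_poly_def using that \<open>i \<in> ?K\<close> by (intro Min_eqI[symmetric]) auto
  qed
  have "trop_hypersurface v f = (\<Union>i\<in>?K. \<Union>j\<in>?K - {i}. 
      \<Inter>k\<in>?K. {w. ?T w i \<le> ?T w k} \<inter> {w. ?T w j \<le> ?T w k})"
    using False by (auto simp: trop_hypersurface_def min_iff)
  moreover have "closed {w. ?T w i \<le> ?T w k}" for i k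
    unfolding trop_term_def by (intro closed_Collect_le continuous_intros)
  ultimately show ?thesis
    by (auto intro!: closed_UN closed_Int)
qed (simp add: trop_hypersurface_def)

context valuation
begin

lemma v_sum_greater:
  assumes "\<And>a. a \<in> A \<Longrightarrow> g a = 0 \<or> v (g a) > c"
  shows "sum g A = 0 \<or> v (sum g A) > c"
  using assms
proof (induction A rule: infinite_finite_induct)
  case (insert a A)
  have "x + y = 0 \<or> v (x + y) > c" if "x = 0 \<or> v x > c" "y = 0 \<or> v y > c" for x y
    using that v_add[of x y] by (cases "x = 0"; cases "y = 0"; cases "x + y = 0") auto
  then show ?case
    using insert by simp
qed auto

lemma v_prod:
  assumes "\<And>a. a \<in> A \<Longrightarrow> g a \<noteq> 0"
  shows "v (prod g A) = (\<Sum>a\<in>A. v (g a))"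
  using assms by (induction A rule: infinite_finite_induct) (auto simp: v_mult)

definition val_vec :: "'a ^ 'n::finite \<Rightarrow> real ^ 'n" where
  "val_vec t = (\<chi> k. v (t $ k))"

text \<open>The easy half of Kapranov's theorem: if one term had strictly smallest valuation at
  \<open>t\<close>, the ultrametric inequality would keep the sum from vanishing.\<close>

lemma val_vec_mem_trop_hypersurface:
  assumes "t \<in> torus" "laurent_eval f t = 0"
  shows "val_vec t \<in> trop_hypersurface v f"
proof (cases "f = 0")
  case False
  let ?K = "Poly_Mapping.keys f" and ?T = "trop_term v f (val_vec t)"
  define g where "g i = Poly_Mapping.lookup f i * (\<Prod>k\<in>UNIV. (t $ k) powi (i $ k))" for i
  have t: "t $ k \<noteq> 0" for k
    using assms(1) by (simp add: torus_def)
  have g_nz: "g i \<noteq> 0" if "i \<in> ?K" for i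
    using that t by (auto simp: g_def in_keys_iff)
  have v_g: "v (g i) = ?T i" if "i \<in> ?K" for i
  proof -
    have "v (g i) = v (Poly_Mapping.lookup f i) + v (\<Prod>k\<in>UNIV. (t $ k) powi (i $ k))"
      unfolding g_def using that t by (intro v_mult) (auto simp: in_keys_iff)
    also have "v (\<Prod>k\<in>UNIV. (t $ k) powi (i $ k)) = of_int_vec i \<bullet> val_vec t"
      using t by (simp add: v_prod v_power_int inner_vec_def of_int_vec_def val_vec_def)
    finally show ?thesis
      by (simp add: trop_term_def)
  qed
  have K: "finite ?K" "?K \<noteq> {}"
    using False by auto
  then have "trop_poly v f (val_vec t) \<in> ?T ` ?K"
    unfolding trop_poly_def by (intro Min_in) auto
  then obtain i where i: "i \<in> ?K" "?T i = trop_poly v f (val_vec t)"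
    by auto
  have "\<exists>j\<in>?K. j \<noteq> i \<and> ?T j \<le> ?T i"
  proof (rule ccontr)
    assume "\<not> ?thesis"
    then have "v (g j) > v (g i)" if "j \<in> ?K - {i}" for j
      using that i by (auto simp: v_g)
    then have "sum g (?K - {i}) = 0 \<or> v (g i) < v (sum g (?K - {i}))"
      by (intro v_sum_greater) auto
    with g_nz[OF i(1)] have "g i + sum g (?K - {i}) \<noteq> 0"
      by (rule v_add_less)
    moreover have "g i + sum g (?K - {i}) = laurent_eval f t"
      unfolding laurent_eval_def g_def using i(1) by (simp add: sum.remove)
    ultimately show False
      using assms(2) by simp
  qed
  then obtain j where j: "j \<in> ?K" "j \<noteq> i" "?T j \<le> ?T i"
    by blast
  moreover have "?T i \<le> ?T j"
    using i j by (simp add: trop_poly_def)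
  ultimately have "?T j = trop_poly v f (val_vec t)"
    using i by simp
  then show ?thesis
    using False i j(1,2) by (simp add: trop_hypersurface_def) blast
qed (simp add: trop_hypersurface_def)

text \<open>Each element of the ideal vanishes on \<open>C\<close> and has a closed tropical
  hypersurface, so all of them are handled at once, without generators.\<close>

lemma closure_val_vec_subset:
  assumes "C \<subseteq> torus"
  shows "closure (val_vec ` C) \<subseteq> trop_variety v (vanishing_ideal C)"
  unfolding trop_variety_def
proof (intro INT_greatest closure_minimal closed_trop_hypersurface)
  show "val_vec ` C \<subseteq> trop_hypersurface v f" if "f \<in> vanishing_ideal C" for f
    using that assms val_vec_mem_trop_hypersurface by (auto simp: vanishing_ideal_def)
qed

section \<open>Density of the value group\<close>

definition value_group :: "real set" where
  "value_group = v ` {x. x \<noteq> 0}"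

text \<open>Roots of every order exist, so the value group is divisible and contains all rational
  multiples of \<open>v x\<close>.\<close>

lemma closure_value_group:
  assumes "x \<noteq> 0" "v x \<noteq> 0"
  shows "closure value_group = UNIV"
proof -
  have "(*) (v x) ` \<rat> \<subseteq> value_group"
  proof (rule image_subsetI)
    fix q :: real assume "q \<in> \<rat>"
    then obtain m n where q: "q = of_int m / of_int n" and "n > 0"
      by (elim Rats_cases')
    then obtain y where y: "y ^ nat n = x"
      using nth_root_exists[of "nat n" x] by auto
    then have "y \<noteq> 0"
      using assms \<open>n > 0\<close> by auto
    then have "v x = n * v y"
      using y v_power[of y "nat n"] \<open>n > 0\<close> by simp
    then have "v x * q = v (y powi m)"
      using \<open>n > 0\<close> \<open>y \<noteq> 0\<close> by (simp add: q v_power_int)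
    then show "v x * q \<in> value_group"
      using \<open>y \<noteq> 0\<close> by (auto simp: value_group_def)
  qed
  moreover have "UNIV = (*) (v x) ` closure \<rat>"
    using assms by (auto simp: Rats_closure_real image_iff intro!: exI[of _ "_ / v x"])
  then have "UNIV \<subseteq> closure ((*) (v x) ` \<rat>)"
    by (metis closure_bounded_linear_image_subset bounded_linear_mult_right)
  ultimately show ?thesis
    using closure_mono by (metis subset_antisym subset_trans top_greatest)
qed

text \<open>Points of the curve are constructed only over values in the open parameter set. Boundary
  points, where further terms tie, and parameters outside the value group are reached by
  closure.\<close>

lemma cell_subset_closure:
  fixes \<gamma> :: "real \<Rightarrow> 'b::topological_space"
  assumes "closure value_group = UNIV" and "open J" and "continuous_on UNIV \<gamma>"
    and "\<And>s. s \<in> J \<Longrightarrow> s \<in> value_group \<Longrightarrow> \<gamma> s \<in> D"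
  shows "\<gamma> ` closure J \<subseteq> closure D"
proof -
  have "J \<subseteq> closure (J \<inter> value_group)"
    using open_Int_closure_subset[OF assms(2), of value_group] assms(1) by simp
  then have "\<gamma> ` closure J \<subseteq> \<gamma> ` closure (J \<inter> value_group)"
    by (intro image_mono closure_minimal) auto
  also have "\<dots> \<subseteq> closure D"
    using assms(3,4)
    by (intro image_closure_subset)
      (auto intro: continuous_on_subset closure_subset[THEN subsetD])
  finally show ?thesis .
qed

end


section \<open>The tropical curve of \<open>y\<^sup>2 + xy + ay = x\<^sup>3\<close>\<close>

text \<open>One parametrization serves edges and rays. For a primitive integer \<open>d\<close> the
  parameter measures lattice length.\<close>

definition ray_or_segment :: "real ^ 2 \<Rightarrow> real ^ 2 \<Rightarrow> real set \<Rightarrow> (real ^ 2) set" where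
  "ray_or_segment p d I = (\<lambda>s. p + s *\<^sub>R d) ` I"

definition vertex0 :: "real ^ 2" where "vertex0 = vector [0, 0]"
definition vertex1 :: "real \<Rightarrow> real ^ 2" where "vertex1 \<alpha> = vector [\<alpha>, \<alpha>]"
definition vertex2 :: "real \<Rightarrow> real ^ 2" where "vertex2 \<alpha> = vector [\<alpha>, 2 * \<alpha>]"

text \<open>
  At \<open>vertex0\<close>, \<open>vertex1 \<alpha>\<close> and \<open>vertex2 \<alpha>\<close> the minimum of \<open>2y\<close>, \<open>x + y\<close>, \<open>\<alpha> + y\<close>, \<open>3x\<close> is attained by
  all terms except \<open>\<alpha> + y\<close>, \<open>3x\<close> and \<open>2y\<close> respectively.
\<close>

definition bounded_cells :: "real \<Rightarrow> (real ^ 2) set set" where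
  "bounded_cells \<alpha> =
     {ray_or_segment vertex0 (vector [1, 1]) {0..\<alpha>},
      ray_or_segment vertex0 (vector [1, 2]) {0..\<alpha>},
      ray_or_segment (vertex1 \<alpha>) (vector [0, 1]) {0..\<alpha>}}"

text \<open>The directions are the primitive inner normals of the sides of the Newton
  triangle.\<close>

definition unbounded_cells :: "real \<Rightarrow> (real ^ 2) set set" where
  "unbounded_cells \<alpha> =
     {ray_or_segment vertex0 (vector [- 2, - 3]) {0..},
      ray_or_segment (vertex1 \<alpha>) (vector [1, 0]) {0..},
      ray_or_segment (vertex2 \<alpha>) (vector [1, 3]) {0..}}"

definition cubic_points :: "'a::field \<Rightarrow> ('a ^ 2) set" where
  "cubic_points a = {t \<in> torus. (t $ 2) ^ 2 + t $ 1 * t $ 2 + a * t $ 2 = (t $ 1) ^ 3}"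

definition cubic_laurent :: "'a::field \<Rightarrow> ('a, 2) laurent" where
  "cubic_laurent a = Poly_Mapping.single (vector [0, 2]) 1 + Poly_Mapping.single (vector [1, 1]) 1
     + Poly_Mapping.single (vector [0, 1]) a + Poly_Mapping.single (vector [3, 0]) (- 1)"

lemma laurent_eval_single_2:
  fixes t :: "'a::field ^ 2"
  shows "laurent_eval (Poly_Mapping.single m c) t = c * (t $ 1 powi (m $ 1) * t $ 2 powi (m $ 2))"
  unfolding laurent_eval_single UNIV_2 by simp

lemma laurent_eval_cubic_laurent:
  "laurent_eval (cubic_laurent a) t = (t $ 2) ^ 2 + t $ 1 * t $ 2 + a * t $ 2 - (t $ 1) ^ 3"
  unfolding cubic_laurent_def laurent_eval_add laurent_eval_single_2 vector_2 by simp

lemma cubic_laurent_mem_vanishing_ideal: "cubic_laurent a \<in> vanishing_ideal (cubic_points a)"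
  by (simp add: vanishing_ideal_def cubic_points_def laurent_eval_cubic_laurent)

lemma of_int_vec_inner_2: "of_int_vec (vector [m, n]) \<bullet> (w :: real ^ 2) = m * w $ 1 + n * w $ 2"
  by (simp add: inner_vec_def of_int_vec_def sum_2)

context valuation
begin

text \<open>Four monomials allow six ties. Those with the interior monomial xy give the bounded
  edges; the others belong to sides of the Newton triangle and give the rays.\<close>

lemma trop_hypersurface_cubic_laurent_subset:
  assumes "a \<noteq> 0" and \<alpha>: "v a = \<alpha>" "\<alpha> > 0"
  shows "trop_hypersurface v (cubic_laurent a) \<subseteq> \<Union>(bounded_cells \<alpha> \<union> unbounded_cells \<alpha>)"
proof
  fix w assume w: "w \<in> trop_hypersurface v (cubic_laurent a)"
  let ?f = "cubic_laurent a"
  let ?x = "w $ 1" and ?y = "w $ 2"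
  define M :: "(int ^ 2) set" where "M = {vector [0, 2], vector [1, 1], vector [0, 1], vector [3, 0]}"
  have lookup: "Poly_Mapping.lookup ?f (vector [0, 2]) = 1" "Poly_Mapping.lookup ?f (vector [1, 1]) = 1"
    "Poly_Mapping.lookup ?f (vector [0, 1]) = a" "Poly_Mapping.lookup ?f (vector [3, 0]) = - 1"
    by (simp_all add: cubic_laurent_def lookup_add lookup_single vec_eq_iff forall_2)
  have keys: "Poly_Mapping.keys ?f = M"
  proof (rule equalityI; rule subsetI)
    fix m assume "m \<in> Poly_Mapping.keys ?f"
    then show "m \<in> M"
      by (auto simp: cubic_laurent_def M_def lookup_add lookup_single in_keys_iff when_def split: if_splits)
  qed (use lookup \<open>a \<noteq> 0\<close> in \<open>auto simp: M_def in_keys_iff\<close>)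
  have trop: "trop_term v ?f w (vector [0, 2]) = 2 * ?y" "trop_term v ?f w (vector [1, 1]) = ?x + ?y"
    "trop_term v ?f w (vector [0, 1]) = \<alpha> + ?y" "trop_term v ?f w (vector [3, 0]) = 3 * ?x"
    by (simp_all add: trop_term_def lookup of_int_vec_inner_2 \<alpha>)
  define \<mu> where "\<mu> = trop_poly v ?f w"
  have le: "\<mu> \<le> trop_term v ?f w m" if "m \<in> M" for m
    using that unfolding \<mu>_def trop_poly_def keys by (intro Min_le) (auto simp: M_def)
  have bounds: "\<mu> \<le> 2 * ?y" "\<mu> \<le> ?x + ?y" "\<mu> \<le> \<alpha> + ?y" "\<mu> \<le> 3 * ?x"
    using le[of "vector [0, 2]"] le[of "vector [1, 1]"] le[of "vector [0, 1]"] le[of "vector [3, 0]"]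
    by (simp_all add: trop M_def)
  have "?f \<noteq> 0"
    using keys by (auto simp: M_def)
  then obtain i j where "i \<in> M" "j \<in> M" "i \<noteq> j"
    and "trop_term v ?f w i = \<mu>" "trop_term v ?f w j = \<mu>"
    using w by (auto simp: trop_hypersurface_def keys \<mu>_def)
  then have "2 * ?y = \<mu> \<and> ?x + ?y = \<mu> \<or> 2 * ?y = \<mu> \<and> \<alpha> + ?y = \<mu> \<or> 2 * ?y = \<mu> \<and> 3 * ?x = \<mu> \<or>
      ?x + ?y = \<mu> \<and> \<alpha> + ?y = \<mu> \<or> ?x + ?y = \<mu> \<and> 3 * ?x = \<mu> \<or> \<alpha> + ?y = \<mu> \<and> 3 * ?x = \<mu>"
    unfolding M_def by (elim insertE emptyE) (simp_all add: trop)
  then consider "2 * ?y = \<mu>" "?x + ?y = \<mu>" | "?x + ?y = \<mu>" "3 * ?x = \<mu>"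
    | "?x + ?y = \<mu>" "\<alpha> + ?y = \<mu>" | "2 * ?y = \<mu>" "3 * ?x = \<mu>"
    | "2 * ?y = \<mu>" "\<alpha> + ?y = \<mu>" | "\<alpha> + ?y = \<mu>" "3 * ?x = \<mu>"
    by blast
  then show "w \<in> \<Union>(bounded_cells \<alpha> \<union> unbounded_cells \<alpha>)"
  proof cases
    case 1
    with bounds have 1: "0 \<le> ?x" "?x \<le> \<alpha>" "?y = ?x"
      by linarith+
    then have "w = vertex0 + ?x *\<^sub>R vector [1, 1]"
      by (simp add: vec_eq_iff forall_2 vertex0_def)
    with 1 show ?thesis
      unfolding bounded_cells_def ray_or_segment_def by auto
  next
    case 2
    with bounds have 2: "0 \<le> ?x" "?x \<le> \<alpha>" "?y = 2 * ?x"
      by linarith+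
    then have "w = vertex0 + ?x *\<^sub>R vector [1, 2]"
      by (simp add: vec_eq_iff forall_2 vertex0_def)
    with 2 show ?thesis
      unfolding bounded_cells_def ray_or_segment_def by auto
  next
    case 3
    with bounds have 3: "?x = \<alpha>" "\<alpha> \<le> ?y" "?y \<le> 2 * \<alpha>"
      by linarith+
    then have "w = vertex1 \<alpha> + (?y - \<alpha>) *\<^sub>R vector [0, 1]"
      by (simp add: vec_eq_iff forall_2 vertex1_def)
    with 3 show ?thesis
      unfolding bounded_cells_def ray_or_segment_def by auto
  next
    case 4
    with bounds have 4: "?x \<le> 0" "2 * ?y = 3 * ?x"
      by linarith+
    \<comment> \<open>The factor 1/2 compensates for the first coordinate -2 of the primitive
      direction.\<close>
    then have "w = vertex0 + (- ?x / 2) *\<^sub>R vector [- 2, - 3]"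
      by (simp add: vec_eq_iff forall_2 vertex0_def)
    moreover have "- ?x / 2 \<in> {0..}"
      using 4 by simp
    ultimately show ?thesis
      unfolding unbounded_cells_def ray_or_segment_def by blast
  next
    case 5
    with bounds have 5: "?y = \<alpha>" "\<alpha> \<le> ?x"
      by linarith+
    then have "w = vertex1 \<alpha> + (?x - \<alpha>) *\<^sub>R vector [1, 0]"
      by (simp add: vec_eq_iff forall_2 vertex1_def)
    with 5 show ?thesis
      unfolding unbounded_cells_def ray_or_segment_def by auto
  next
    case 6
    with bounds have 6: "\<alpha> \<le> ?x" "?y = 3 * ?x - \<alpha>"
      by linarith+
    then have "w = vertex2 \<alpha> + (?x - \<alpha>) *\<^sub>R vector [1, 3]"
      by (simp add: vec_eq_iff forall_2 vertex2_def algebra_simps)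
    with 6 show ?thesis
      unfolding unbounded_cells_def ray_or_segment_def by auto
  qed
qed

section \<open>Points of the cubic with prescribed valuations\<close>

lemma quadratic_root:
  assumes "b \<noteq> 0" "c \<noteq> 0"
    and "2 * w = \<mu> \<and> v b + w = \<mu> \<and> \<mu> \<le> v c \<or> 2 * w = \<mu> \<and> v c = \<mu> \<and> \<mu> \<le> v b + w \<or>
         v b + w = \<mu> \<and> v c = \<mu> \<and> \<mu> \<le> 2 * w"
  obtains y where "y \<noteq> 0" "v y = w" "y ^ 2 + b * y + c = 0"
proof -
  let ?p = "[:c, b, 1:]"
  have le: "\<mu> \<le> v (coeff ?p k) + k * w" if "k \<le> degree ?p" for k
  proof -
    have "k = 0 \<or> k = 1 \<or> k = 2"
      using that by auto
    then show ?thesis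
      using assms(3) by (auto simp: numeral_2_eq_2)
  qed
  have "\<exists>i j. i \<noteq> j \<and> coeff ?p i \<noteq> 0 \<and> coeff ?p j \<noteq> 0 \<and>
      v (coeff ?p i) + i * w = \<mu> \<and> v (coeff ?p j) + j * w = \<mu>"
    using assms(3)
  proof (elim disjE conjE)
    assume "2 * w = \<mu>" "v b + w = \<mu>"
    with assms show ?thesis by (intro exI[of _ 1] exI[of _ 2]) (simp add: numeral_2_eq_2)
  next
    assume "2 * w = \<mu>" "v c = \<mu>"
    with assms show ?thesis by (intro exI[of _ 0] exI[of _ 2]) (simp add: numeral_2_eq_2)
  next
    assume "v b + w = \<mu>" "v c = \<mu>"
    with assms show ?thesis by (intro exI[of _ 0] exI[of _ 1]) simp
  qed
  then obtain y where "y \<noteq> 0" "poly ?p y = 0" "v y = w"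
    using newton_polygon_root[of _ _ ?p w \<mu>] le by metis
  then show thesis
    by (intro that[of y]) (simp_all add: power2_eq_square algebra_simps)
qed

text \<open>For fixed \<open>x\<close> the equation is quadratic in y with coefficients
  \<open>x + a\<close> and \<open>- (x ^ 3)\<close>. Keeping \<open>v (x + a)\<close> as a parameter
  lets one lemma serve both v x < v a and v x > v a.\<close>

lemma cubic_point_over_x:
  assumes "x \<noteq> 0" "x + a \<noteq> 0" "v x = w $ 1"
    and "2 * w $ 2 = \<mu> \<and> v (x + a) + w $ 2 = \<mu> \<and> \<mu> \<le> 3 * w $ 1 \<or>
         2 * w $ 2 = \<mu> \<and> 3 * w $ 1 = \<mu> \<and> \<mu> \<le> v (x + a) + w $ 2 \<or>
         v (x + a) + w $ 2 = \<mu> \<and> 3 * w $ 1 = \<mu> \<and> \<mu> \<le> 2 * w $ 2"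
  shows "w \<in> val_vec ` cubic_points a"
proof -
  have "v (- (x ^ 3)) = 3 * w $ 1"
    using assms by (simp add: v_power)
  then obtain y where y: "y \<noteq> 0" "v y = w $ 2" "y ^ 2 + (x + a) * y + - (x ^ 3) = 0"
    using quadratic_root[of "x + a" "- (x ^ 3)" "w $ 2" \<mu>] assms by auto
  have "(vector [x, y] :: 'a ^ 2) \<in> cubic_points a"
    using y assms(1) by (simp add: cubic_points_def torus_def forall_2 algebra_simps)
  moreover have "w = val_vec (vector [x, y])"
    using y assms(3) by (simp add: val_vec_def vec_eq_iff forall_2)
  ultimately show ?thesis
    by blast
qed

text \<open>Along the vertical edge v x = v a, so cancellation may give \<open>x + a\<close> any
  larger valuation. There \<open>y\<close> is prescribed instead and a cubic in x is solved.\<close>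

lemma cubic_point_over_y:
  assumes "a \<noteq> 0" "v a = \<alpha>" "y \<noteq> 0" "v y = \<alpha> + s" "0 < s" "s < \<alpha>"
  shows "vector [\<alpha>, \<alpha> + s] \<in> val_vec ` cubic_points a"
proof -
  \<comment> \<open>As v y > v a, the factor \<open>a + y\<close> has valuation \<alpha>. At
    \<alpha> the constant and the linear term of the cubic tie, and s < \<alpha> keeps x^3 above
    them.\<close>
  define c where "c = - (y * (a + y))"
  have "a + y \<noteq> 0" "v (a + y) = \<alpha>"
    using v_add_less[of a y] assms by auto
  then have c: "c \<noteq> 0" "v c = 2 * \<alpha> + s"
    using assms by (simp_all add: c_def v_mult)
  let ?p = "[:c, - y, 0, 1:]"
  obtain x where x: "x \<noteq> 0" "poly ?p x = 0" "v x = \<alpha>"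
  proof (rule newton_polygon_root[of 0 1 ?p \<alpha> "2 * \<alpha> + s"])
    show "2 * \<alpha> + s \<le> v (coeff ?p k) + k * \<alpha>" if "k \<le> degree ?p" "coeff ?p k \<noteq> 0" for k
    proof -
      have "k = 0 \<or> k = 1 \<or> k = 2 \<or> k = 3"
        using that by auto
      then show ?thesis
        using that c assms by (auto simp: numeral_2_eq_2 numeral_3_eq_3)
    qed
  qed (use c assms in simp_all)
  have "x ^ 3 - y * x - y * (a + y) = 0"
    using x(2) by (simp add: c_def power3_eq_cube algebra_simps)
  then have "(vector [x, y] :: 'a ^ 2) \<in> cubic_points a"
    using x assms by (simp add: cubic_points_def torus_def forall_2 power2_eq_square algebra_simps)
  moreover have "vector [\<alpha>, \<alpha> + s] = val_vec (vector [x, y] :: 'a ^ 2)"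
    using x assms by (simp add: val_vec_def vec_eq_iff forall_2)
  ultimately show ?thesis
    by blast
qed

text \<open>Each open cell is covered by prescribing one coordinate. The \<open>x\<close> in the two
  local bounds only witnesses that the parameter \<open>s\<close> is a value; the coordinate
  actually used is built from it.\<close>

lemma cells_subset_closure:
  assumes "a \<noteq> 0" and \<alpha>: "v a = \<alpha>" "\<alpha> > 0"
  shows "\<Union>(bounded_cells \<alpha> \<union> unbounded_cells \<alpha>) \<subseteq> closure (val_vec ` cubic_points a)"
proof -
  let ?D = "val_vec ` cubic_points a"
  have dense: "closure value_group = UNIV"
    using closure_value_group[of a] assms by simp
  have bounded: "ray_or_segment p d {0..\<alpha>} \<subseteq> closure ?D"
    if "\<And>x s. x \<noteq> 0 \<Longrightarrow> v x = s \<Longrightarrow> 0 < s \<Longrightarrow> s < \<alpha> \<Longrightarrow> p + s *\<^sub>R d \<in> ?D" for p d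
    using cell_subset_closure[OF dense, of "{0<..<\<alpha>}" "\<lambda>s. p + s *\<^sub>R d" ?D] that \<alpha>(2)
    unfolding ray_or_segment_def value_group_def
    by (force intro!: continuous_intros simp: closure_greaterThanLessThan)
  have unbounded: "ray_or_segment p d {0..} \<subseteq> closure ?D"
    if "\<And>x s. x \<noteq> 0 \<Longrightarrow> v x = s \<Longrightarrow> 0 < s \<Longrightarrow> p + s *\<^sub>R d \<in> ?D" for p d
    using cell_subset_closure[OF dense, of "{0<..}" "\<lambda>s. p + s *\<^sub>R d" ?D] that
    unfolding ray_or_segment_def value_group_def by (force intro!: continuous_intros)
  have small: "x + a \<noteq> 0 \<and> v (x + a) = v x" if "x \<noteq> 0" "v x < \<alpha>" for x
    using v_add_less[of x a] that \<alpha> by auto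
  have large: "x + a \<noteq> 0 \<and> v (x + a) = \<alpha>" if "x \<noteq> 0" "\<alpha> < v x" for x
    using v_add_less[of a x] that \<alpha> \<open>a \<noteq> 0\<close> by (auto simp: add.commute)
  have "ray_or_segment vertex0 (vector [1, 1]) {0..\<alpha>} \<subseteq> closure ?D"
  proof (rule bounded)
    fix x s assume "x \<noteq> 0" "v x = s" "0 < s" "s < \<alpha>"
    then show "vertex0 + s *\<^sub>R vector [1, 1] \<in> ?D"
      \<comment> \<open>The last argument is the common value \<mu> of the tying terms.\<close>
      using small[of x] by (intro cubic_point_over_x[of x a _ "2 * s"]) (auto simp: vertex0_def)
  qed
  moreover have "ray_or_segment vertex0 (vector [1, 2]) {0..\<alpha>} \<subseteq> closure ?D"
  proof (rule bounded)
    fix x s assume "x \<noteq> 0" "v x = s" "0 < s" "s < \<alpha>"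
    then show "vertex0 + s *\<^sub>R vector [1, 2] \<in> ?D"
      using small[of x] by (intro cubic_point_over_x[of x a _ "3 * s"]) (auto simp: vertex0_def)
  qed
  moreover have "ray_or_segment (vertex1 \<alpha>) (vector [0, 1]) {0..\<alpha>} \<subseteq> closure ?D"
  proof (rule bounded)
    fix x s assume x: "x \<noteq> 0" "v x = s" "0 < s" "s < \<alpha>"
    have "vertex1 \<alpha> + s *\<^sub>R vector [0, 1] = vector [\<alpha>, \<alpha> + s]"
      by (simp add: vertex1_def vec_eq_iff forall_2)
    then show "vertex1 \<alpha> + s *\<^sub>R vector [0, 1] \<in> ?D"
      \<comment> \<open>Multiplication by \<open>a\<close> moves the valuation from s to \<alpha> +
        s.\<close>
      using cubic_point_over_y[of a \<alpha> "a * x" s] x assms by (simp add: v_mult)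
  qed
  moreover have "ray_or_segment vertex0 (vector [- 2, - 3]) {0..} \<subseteq> closure ?D"
  proof (rule unbounded)
    fix x s assume x: "x \<noteq> 0" "v x = s" "0 < s"
    \<comment> \<open>At ray parameter \<open>s\<close> the first coordinate must have valuation
      -2s, which \<open>inverse x ^ 2\<close> realizes.\<close>
    then have "v (inverse x ^ 2) = - 2 * s" "inverse x ^ 2 \<noteq> 0"
      by (simp_all add: v_power v_inverse)
    then show "vertex0 + s *\<^sub>R vector [- 2, - 3] \<in> ?D"
      using small[of "inverse x ^ 2"] x \<alpha>
      by (intro cubic_point_over_x[of "inverse x ^ 2" a _ "- 6 * s"]) (auto simp: vertex0_def)
  qed
  moreover have "ray_or_segment (vertex1 \<alpha>) (vector [1, 0]) {0..} \<subseteq> closure ?D"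
  proof (rule unbounded)
    fix x s assume x: "x \<noteq> 0" "v x = s" "0 < s"
    then have "v (a * x) = \<alpha> + s" "a * x \<noteq> 0"
      using assms by (simp_all add: v_mult)
    then show "vertex1 \<alpha> + s *\<^sub>R vector [1, 0] \<in> ?D"
      using large[of "a * x"] x \<alpha>
      by (intro cubic_point_over_x[of "a * x" a _ "2 * \<alpha>"]) (auto simp: vertex1_def)
  qed
  moreover have "ray_or_segment (vertex2 \<alpha>) (vector [1, 3]) {0..} \<subseteq> closure ?D"
  proof (rule unbounded)
    fix x s assume x: "x \<noteq> 0" "v x = s" "0 < s"
    then have "v (a * x) = \<alpha> + s" "a * x \<noteq> 0"
      using assms by (simp_all add: v_mult)
    then show "vertex2 \<alpha> + s *\<^sub>R vector [1, 3] \<in> ?D"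
      using large[of "a * x"] x \<alpha>
      by (intro cubic_point_over_x[of "a * x" a _ "3 * \<alpha> + 3 * s"]) (auto simp: vertex2_def)
  qed
  ultimately show ?thesis
    by (simp add: bounded_cells_def unbounded_cells_def)
qed

lemma trop_variety_cubic_points:
  assumes "a \<noteq> 0" "v a = \<alpha>" "\<alpha> > 0"
  shows "trop_variety v (vanishing_ideal (cubic_points a)) = \<Union>(bounded_cells \<alpha> \<union> unbounded_cells \<alpha>)"
proof
  show "trop_variety v (vanishing_ideal (cubic_points a)) \<subseteq> \<Union>(bounded_cells \<alpha> \<union> unbounded_cells \<alpha>)"
    using trop_hypersurface_cubic_laurent_subset[OF assms] cubic_laurent_mem_vanishing_ideal
    unfolding trop_variety_def by blast
  have "cubic_points a \<subseteq> torus"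
    by (auto simp: cubic_points_def)
  then show "\<Union>(bounded_cells \<alpha> \<union> unbounded_cells \<alpha>) \<subseteq> trop_variety v (vanishing_ideal (cubic_points a))"
    using cells_subset_closure[OF assms] closure_val_vec_subset by blast
qed

end


section \<open>Graph structure and cycle\<close>

text \<open>A coordinate equal to 1 makes \<open>w\<close> primitive. It also settles uniqueness in
  \<open>lattice_length\<close>: any primitive \<open>u\<close> along the segment is
  \<open>u $ k\<close> times \<open>w\<close>, so \<open>u $ k\<close> divides 1.\<close>

lemma lattice_length_unit_direction:
  fixes w :: "int ^ 'n::finite"
  assumes "w $ k = 1" "l > 0"
  shows "lattice_length (closed_segment P (P + l *\<^sub>R of_int_vec w)) = l"
proof -
  have dvd_1: "c dvd 1" if "primitive u" "\<And>i. c dvd u $ i" for c :: int and u :: "int ^ 'n"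
  proof -
    have "c dvd Gcd {u $ i | i. True}"
      by (rule Gcd_greatest) (use that(2) in auto)
    then show ?thesis
      using that(1) by (simp add: primitive_def)
  qed
  have "primitive w"
  proof -
    have "Gcd {w $ i | i. True} dvd w $ k"
      by (rule Gcd_dvd) blast
    then have "is_unit (Gcd {w $ i | i. True})"
      using assms(1) by simp
    moreover have "normalize (Gcd {w $ i | i. True}) = Gcd {w $ i | i. True}"
      by simp
    ultimately show ?thesis
      unfolding primitive_def by (metis is_unit_normalize)
  qed
  show ?thesis
    unfolding lattice_length_def
  proof (rule the_equality)
    show "0 \<le> l \<and> (\<exists>P' Q u. closed_segment P (P + l *\<^sub>R of_int_vec w) = closed_segment P' Q \<and>
        primitive u \<and> Q - P' = l *\<^sub>R of_int_vec u)"
      using assms \<open>primitive w\<close> by (intro conjI exI[of _ P] exI[of _ "P + l *\<^sub>R of_int_vec w"] exI[of _ w]) auto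
  next
    fix l' assume l': "0 \<le> l' \<and> (\<exists>P' Q u. closed_segment P (P + l *\<^sub>R of_int_vec w) = closed_segment P' Q \<and>
        primitive u \<and> Q - P' = l' *\<^sub>R of_int_vec u)"
    then obtain P' Q u where seg: "closed_segment P (P + l *\<^sub>R of_int_vec w) = closed_segment P' Q"
      and u: "primitive u" "Q - P' = l' *\<^sub>R of_int_vec u"
      by blast
    from seg have "{P, P + l *\<^sub>R of_int_vec w} = {P', Q}"
      by (simp add: closed_segment_eq)
    \<comment> \<open>A segment determines its endpoints only up to order; \<epsilon> records the
      orientation.\<close>
    then obtain \<epsilon> :: int where \<epsilon>: "\<epsilon> = 1 \<or> \<epsilon> = - 1" and eq: "Q - P' = (\<epsilon> * l) *\<^sub>R of_int_vec w"
    proof -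
      from \<open>{P, P + l *\<^sub>R of_int_vec w} = {P', Q}\<close>
      consider "P = P'" "P + l *\<^sub>R of_int_vec w = Q" | "P = Q" "P + l *\<^sub>R of_int_vec w = P'"
        by (auto simp: doubleton_eq_iff)
      then show thesis
        by cases (use that[of 1] that[of "- 1"] in auto)
    qed
    have comp: "l' * u $ i = \<epsilon> * l * w $ i" for i
      using arg_cong[OF trans[OF u(2)[symmetric] eq], of "\<lambda>x. x $ i"] by (simp add: of_int_vec_def)
    have "l' * (u $ k) = \<epsilon> * l"
      using comp[of k] assms(1) by simp
    then have "l' \<noteq> 0"
      using \<epsilon> assms(2) by auto
    have "u $ i = u $ k * w $ i" for i
    proof -
      have "l' * (u $ i) = l' * (u $ k * w $ i)"
        using comp[of i] \<open>l' * (u $ k) = \<epsilon> * l\<close> by simp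
      then show ?thesis
        using \<open>l' \<noteq> 0\<close> by (metis mult_cancel_left of_int_eq_iff)
    qed
    then have "u $ k dvd u $ i" for i
      unfolding dvd_def by blast
    then have "u $ k dvd 1"
      by (rule dvd_1[OF u(1)])
    then have "u $ k = 1 \<or> u $ k = - 1"
      by auto
    then show "l' = l"
      using \<open>l' * (u $ k) = \<epsilon> * l\<close> \<epsilon> l' assms(2) by auto
  qed
qed

section \<open>Faces, dimension and slope of segments and rays\<close>

lemma nonempty_face_of_aff_dim_1:
  fixes S :: "'a::euclidean_space set"
  assumes "convex S" "aff_dim S = 1" "F face_of S" "F \<noteq> {}"
  shows "F = S \<or> (\<exists>x. F = {x} \<and> x extreme_point_of S)"
proof (cases "F = S")
  case False
  then have "aff_dim F < 1"
    using face_of_aff_dim_lt[OF assms(1,3)] assms(2) by simp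
  moreover have "aff_dim F \<ge> 0"
    using assms(4) aff_dim_empty[of F] aff_dim_geq[of F] by linarith
  ultimately obtain x where "F = {x}"
    using aff_dim_eq_0[of F] by auto
  then show ?thesis
    using assms(3) by (simp add: face_of_singleton)
qed simp

lemma ray_or_segment_bounded:
  assumes "l > 0"
  shows "ray_or_segment p d {0..l} = closed_segment p (p + l *\<^sub>R d)"
proof -
  have "{0..l} = (\<lambda>u. u * l) ` {0..1}"
    using assms by (simp add: image_mult_atLeastAtMost_if')
  then show ?thesis
    by (simp add: ray_or_segment_def closed_segment_image_interval image_image algebra_simps)
qed

lemma convex_ray_or_segment: "convex I \<Longrightarrow> convex (ray_or_segment p d I)"
proof -
  assume "convex I"
  then have "convex ((+) p ` (\<lambda>s. s *\<^sub>R d) ` I)"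
    by (intro convex_translation convex_linear_image) (auto intro: linearI simp: algebra_simps)
  then show ?thesis
    by (simp add: ray_or_segment_def image_image)
qed

lemma aff_dim_ray_or_segment:
  assumes "0 \<in> I" "l \<in> I" "l \<noteq> 0" "d \<noteq> 0"
  shows "aff_dim (ray_or_segment p d I) = 1"
proof -
  have "ray_or_segment p d I \<subseteq> affine hull {p, p + d}"
  proof
    fix x assume "x \<in> ray_or_segment p d I"
    then obtain s where "x = (1 - s) *\<^sub>R p + s *\<^sub>R (p + d)"
      by (auto simp: ray_or_segment_def algebra_simps)
    then show "x \<in> affine hull {p, p + d}"
      unfolding affine_hull_2 by (intro CollectI exI[of _ "1 - s"] exI[of _ s]) simp
  qed
  then have "aff_dim (ray_or_segment p d I) \<le> aff_dim {p, p + d}"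
    using aff_dim_subset by (metis aff_dim_affine_hull)
  moreover have "{p, p + l *\<^sub>R d} \<subseteq> ray_or_segment p d I"
    using assms by (force simp: ray_or_segment_def)
  then have "aff_dim {p, p + l *\<^sub>R d} \<le> aff_dim (ray_or_segment p d I)"
    by (rule aff_dim_subset)
  ultimately show ?thesis
    using assms by simp
qed

lemma rational_slope_ray_or_segment:
  assumes "w \<noteq> 0"
  shows "rational_slope (ray_or_segment p (of_int_vec w) I)"
  unfolding rational_slope_def
proof (intro exI[of _ w] conjI ballI assms)
  fix x y assume "x \<in> ray_or_segment p (of_int_vec w) I" "y \<in> ray_or_segment p (of_int_vec w) I"
  then obtain s t where "x = p + s *\<^sub>R of_int_vec w" "y = p + t *\<^sub>R of_int_vec w"
    by (auto simp: ray_or_segment_def)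
  then show "\<exists>c. y - x = c *\<^sub>R of_int_vec w"
    by (intro exI[of _ "t - s"]) (simp add: algebra_simps)
qed

lemma polyhedron_ray:
  assumes "d \<noteq> 0"
  shows "polyhedron (ray_or_segment p d {0..})"
proof -
  \<comment> \<open>A quarter turn of \<open>d\<close>: the ray is the line through \<open>p\<close>
    normal to \<open>e\<close>, cut by a half-plane whose boundary is normal to
    \<open>d\<close>.\<close>
  define e :: "real ^ 2" where "e = vector [- d $ 2, d $ 1]"
  have "ray_or_segment p d {0..} = {x. e \<bullet> x = e \<bullet> p} \<inter> {x. d \<bullet> x \<ge> d \<bullet> p}"
  proof (rule equalityI; rule subsetI)
    fix x assume "x \<in> ray_or_segment p d {0..}"
    moreover have "e \<bullet> d = 0"
      by (simp add: e_def inner_vec_def sum_2)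
    ultimately show "x \<in> {x. e \<bullet> x = e \<bullet> p} \<inter> {x. d \<bullet> x \<ge> d \<bullet> p}"
      by (auto simp: ray_or_segment_def inner_add_right)
  next
    fix x assume x: "x \<in> {x. e \<bullet> x = e \<bullet> p} \<inter> {x. d \<bullet> x \<ge> d \<bullet> p}"
    \<comment> \<open>\<open>n\<close> is the squared length of \<open>d\<close>, and
      \<open>s\<close> the coefficient of the orthogonal projection of \<open>x - p\<close> onto
      \<open>d\<close>.\<close>
    define n where "n = (d $ 1)\<^sup>2 + (d $ 2)\<^sup>2"
    define s where "s = (d \<bullet> x - d \<bullet> p) / n"
    have n: "n > 0"
      using assms by (auto simp: n_def vec_eq_iff forall_2 sum_power2_gt_zero_iff)
    have perp: "d $ 1 * (x $ 2 - p $ 2) = d $ 2 * (x $ 1 - p $ 1)"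
      using x by (simp add: e_def inner_vec_def sum_2 algebra_simps)
    have s: "s * n = d $ 1 * (x $ 1 - p $ 1) + d $ 2 * (x $ 2 - p $ 2)"
      using n by (simp add: s_def) (simp add: inner_vec_def sum_2 algebra_simps)
    have "s * d $ 1 * n = d $ 1 * (d $ 1 * (x $ 1 - p $ 1)) + d $ 2 * (d $ 1 * (x $ 2 - p $ 2))"
      using arg_cong[OF s, of "\<lambda>r. d $ 1 * r"] by (simp add: algebra_simps)
    also have "\<dots> = (x $ 1 - p $ 1) * n"
      unfolding perp by (simp add: n_def power2_eq_square algebra_simps)
    finally have 1: "s * d $ 1 = x $ 1 - p $ 1"
      using n by simp
    have "s * d $ 2 * n = d $ 1 * (d $ 2 * (x $ 1 - p $ 1)) + d $ 2 * (d $ 2 * (x $ 2 - p $ 2))"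
      using arg_cong[OF s, of "\<lambda>r. d $ 2 * r"] by (simp add: algebra_simps)
    also have "\<dots> = (x $ 2 - p $ 2) * n"
      unfolding perp[symmetric] by (simp add: n_def power2_eq_square algebra_simps)
    finally have 2: "s * d $ 2 = x $ 2 - p $ 2"
      using n by simp
    have "x = p + s *\<^sub>R d" "s \<in> {0..}"
      using 1 2 x n by (simp_all add: vec_eq_iff forall_2 s_def)
    then show "x \<in> ray_or_segment p d {0..}"
      unfolding ray_or_segment_def by blast
  qed
  then show ?thesis
    using polyhedron_hyperplane[of e "e \<bullet> p"] polyhedron_halfspace_ge[of "d \<bullet> p" d] by simp
qed

text \<open>A point at parameter s > 0 is the midpoint of \<open>p\<close> and the point at 2s.
  Conversely, a combination of nonnegative parameters with positive weights is 0 only if both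
  are.\<close>

lemma extreme_point_of_ray:
  assumes "d \<noteq> 0"
  shows "x extreme_point_of ray_or_segment p d {0..} \<longleftrightarrow> x = p"
proof
  assume x: "x extreme_point_of ray_or_segment p d {0..}"
  then obtain s where s: "x = p + s *\<^sub>R d" "s \<ge> 0"
    by (auto simp: extreme_point_of_def ray_or_segment_def)
  have "p \<in> ray_or_segment p d {0..}" "p + (2 * s) *\<^sub>R d \<in> ray_or_segment p d {0..}"
    using s by (force simp: ray_or_segment_def)+
  then have "x \<notin> open_segment p (p + (2 * s) *\<^sub>R d)"
    using x by (simp add: extreme_point_of_def)
  moreover have "x \<in> open_segment p (p + (2 * s) *\<^sub>R d)" if "s \<noteq> 0"
    unfolding in_segment using that s assms
    by (intro conjI exI[of _ "1/2"]) (auto simp: algebra_simps simp flip: scaleR_left_distrib)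
  ultimately show "x = p"
    using s by auto
next
  assume "x = p"
  moreover have "p \<notin> open_segment a b" if ab: "a \<in> ray_or_segment p d {0..}" "b \<in> ray_or_segment p d {0..}" for a b
  proof
    assume p: "p \<in> open_segment a b"
    from ab obtain s t where st: "a = p + s *\<^sub>R d" "b = p + t *\<^sub>R d" "s \<ge> 0" "t \<ge> 0"
      by (auto simp: ray_or_segment_def)
    from p obtain u where u: "0 < u" "u < 1" "p = (1 - u) *\<^sub>R a + u *\<^sub>R b" and "a \<noteq> b"
      unfolding in_segment by auto
    then have "((1 - u) * s + u * t) *\<^sub>R d = 0"
      by (simp add: st algebra_simps)
    then have "(1 - u) * s + u * t = 0"
      using assms by simp
    then have "s = 0 \<and> t = 0"
      using u st by (smt (verit) mult_nonneg_nonneg mult_pos_pos)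
    then show False
      using \<open>a \<noteq> b\<close> st by simp
  qed
  moreover have "p \<in> ray_or_segment p d {0..}"
    by (force simp: ray_or_segment_def)
  ultimately show "x extreme_point_of ray_or_segment p d {0..}"
    by (simp add: extreme_point_of_def)
qed

section \<open>The tropical curve as a polyhedral complex\<close>

context
  fixes \<alpha> :: real
  assumes \<alpha>: "\<alpha> > 0"
begin

abbreviation cells :: "(real ^ 2) set set" where
  "cells \<equiv> bounded_cells \<alpha> \<union> unbounded_cells \<alpha>"

abbreviation vertices :: "(real ^ 2) set" where
  "vertices \<equiv> {vertex0, vertex1 \<alpha>, vertex2 \<alpha>}"

lemma of_int_vec_2: "of_int_vec (vector [m, n] :: int ^ 2) = vector [of_int m, of_int n]"
  by (simp add: of_int_vec_def vec_eq_iff forall_2)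

lemma vertices_distinct: "vertex0 \<noteq> vertex1 \<alpha>" "vertex0 \<noteq> vertex2 \<alpha>" "vertex1 \<alpha> \<noteq> vertex2 \<alpha>"
  using \<alpha> by (simp_all add: vertex0_def vertex1_def vertex2_def vec_eq_iff forall_2)

lemma bounded_cells_closed_segment:
  "bounded_cells \<alpha> = {closed_segment vertex0 (vertex1 \<alpha>), closed_segment vertex0 (vertex2 \<alpha>),
     closed_segment (vertex1 \<alpha>) (vertex2 \<alpha>)}"
proof -
  have "vertex0 + \<alpha> *\<^sub>R vector [1, 1] = vertex1 \<alpha>" "vertex0 + \<alpha> *\<^sub>R vector [1, 2] = vertex2 \<alpha>"
    "vertex1 \<alpha> + \<alpha> *\<^sub>R vector [0, 1] = vertex2 \<alpha>"
    by (simp_all add: vertex0_def vertex1_def vertex2_def vec_eq_iff forall_2)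
  then show ?thesis
    by (simp add: bounded_cells_def ray_or_segment_bounded[OF \<alpha>])
qed

lemma bounded_cell_cases:
  assumes "C \<in> bounded_cells \<alpha>"
  obtains P Q where "P \<in> vertices" "Q \<in> vertices" "P \<noteq> Q" "C = closed_segment P Q"
  using assms vertices_distinct unfolding bounded_cells_closed_segment by blast

lemma unbounded_cell_cases:
  assumes "C \<in> unbounded_cells \<alpha>"
  obtains P d where "P \<in> vertices" "d \<noteq> 0" "C = ray_or_segment P d {0..}"
proof -
  have "vector [- 2, - 3] \<noteq> (0 :: real ^ 2)" "vector [1, 0] \<noteq> (0 :: real ^ 2)" "vector [1, 3] \<noteq> (0 :: real ^ 2)"
    by (simp_all add: vec_eq_iff forall_2)
  then show thesis
    using assms that unfolding unbounded_cells_def by blast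
qed

text \<open>Treats edges and rays alike: the integer direction gives rational slope, and the
  parameters 0 and \<alpha> give two distinct points, hence dimension one.\<close>

lemma cell_cases:
  assumes "C \<in> cells"
  obtains p d I w where "C = ray_or_segment p d I" "d = of_int_vec w" "w \<noteq> 0" "convex I" "0 \<in> I" "\<alpha> \<in> I"
proof -
  define W :: "(int ^ 2) set" where
    "W = {vector [1, 1], vector [1, 2], vector [0, 1], vector [- 2, - 3], vector [1, 0], vector [1, 3]}"
  have "0 \<notin> W"
    by (simp add: W_def vec_eq_iff forall_2)
  moreover have "\<exists>p I. \<exists>w\<in>W. C = ray_or_segment p (of_int_vec w) I \<and> (I = {0..\<alpha>} \<or> I = {0..})"
    using assms unfolding bounded_cells_def unbounded_cells_def W_def
    by (simp add: of_int_vec_2) blast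
  ultimately show thesis
    using that \<alpha> by (metis atLeastAtMost_iff atLeast_iff convex_real_interval(5) convex_real_interval(1) less_eq_real_def)
qed

lemma convex_cell: "C \<in> cells \<Longrightarrow> convex C"
  by (elim cell_cases) (simp add: convex_ray_or_segment)

lemma rational_slope_cell: "C \<in> cells \<Longrightarrow> rational_slope C"
  by (elim cell_cases) (simp add: rational_slope_ray_or_segment)

lemma aff_dim_cell:
  assumes "C \<in> cells"
  shows "aff_dim C = 1"
proof -
  obtain p d I w where *: "C = ray_or_segment p d I" "d = of_int_vec w" "w \<noteq> 0" "0 \<in> I" "\<alpha> \<in> I"
    using assms by (elim cell_cases)
  then have "d \<noteq> 0"
    by (auto simp: of_int_vec_def vec_eq_iff)
  with * \<alpha> show ?thesis
    using aff_dim_ray_or_segment[of I \<alpha> d p] by simp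
qed

lemma polyhedron_cell:
  assumes "C \<in> cells"
  shows "polyhedron C"
  using assms
proof
  assume "C \<in> bounded_cells \<alpha>"
  then obtain P Q where "C = closed_segment P Q"
    by (elim bounded_cell_cases)
  then show ?thesis
    by (simp add: segment_convex_hull polyhedron_convex_hull)
next
  assume "C \<in> unbounded_cells \<alpha>"
  then show ?thesis
    by (elim unbounded_cell_cases) (simp add: polyhedron_ray)
qed

text \<open>Coordinate conditions reduce incidence and intersection of cells to linear
  arithmetic.\<close>

lemma mem_bounded_cells:
  "x \<in> ray_or_segment vertex0 (vector [1, 1]) {0..\<alpha>} \<longleftrightarrow> 0 \<le> x $ 1 \<and> x $ 1 \<le> \<alpha> \<and> x $ 2 = x $ 1"
  "x \<in> ray_or_segment vertex0 (vector [1, 2]) {0..\<alpha>} \<longleftrightarrow> 0 \<le> x $ 1 \<and> x $ 1 \<le> \<alpha> \<and> x $ 2 = 2 * x $ 1"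
  "x \<in> ray_or_segment (vertex1 \<alpha>) (vector [0, 1]) {0..\<alpha>} \<longleftrightarrow> x $ 1 = \<alpha> \<and> \<alpha> \<le> x $ 2 \<and> x $ 2 \<le> 2 * \<alpha>"
proof -
  show "x \<in> ray_or_segment (vertex1 \<alpha>) (vector [0, 1]) {0..\<alpha>} \<longleftrightarrow> x $ 1 = \<alpha> \<and> \<alpha> \<le> x $ 2 \<and> x $ 2 \<le> 2 * \<alpha>"
    by (auto simp: ray_or_segment_def vertex1_def vec_eq_iff forall_2 image_iff
        intro!: bexI[of _ "x $ 2 - \<alpha>"])
qed (auto simp: ray_or_segment_def vertex0_def vec_eq_iff forall_2 image_iff)

lemma mem_unbounded_cells:
  "x \<in> ray_or_segment vertex0 (vector [- 2, - 3]) {0..} \<longleftrightarrow> x $ 1 \<le> 0 \<and> 2 * x $ 2 = 3 * x $ 1"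
  "x \<in> ray_or_segment (vertex1 \<alpha>) (vector [1, 0]) {0..} \<longleftrightarrow> \<alpha> \<le> x $ 1 \<and> x $ 2 = \<alpha>"
  "x \<in> ray_or_segment (vertex2 \<alpha>) (vector [1, 3]) {0..} \<longleftrightarrow> \<alpha> \<le> x $ 1 \<and> x $ 2 = 3 * x $ 1 - \<alpha>"
proof -
  show "x \<in> ray_or_segment vertex0 (vector [- 2, - 3]) {0..} \<longleftrightarrow> x $ 1 \<le> 0 \<and> 2 * x $ 2 = 3 * x $ 1"
    by (auto simp: ray_or_segment_def vertex0_def vec_eq_iff forall_2 image_iff
        intro!: bexI[of _ "- (x $ 1) / 2"])
  show "x \<in> ray_or_segment (vertex1 \<alpha>) (vector [1, 0]) {0..} \<longleftrightarrow> \<alpha> \<le> x $ 1 \<and> x $ 2 = \<alpha>"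
    by (auto simp: ray_or_segment_def vertex1_def vec_eq_iff forall_2 image_iff
        intro!: bexI[of _ "x $ 1 - \<alpha>"])
  show "x \<in> ray_or_segment (vertex2 \<alpha>) (vector [1, 3]) {0..} \<longleftrightarrow> \<alpha> \<le> x $ 1 \<and> x $ 2 = 3 * x $ 1 - \<alpha>"
    by (auto simp: ray_or_segment_def vertex2_def vec_eq_iff forall_2 image_iff
        intro!: bexI[of _ "x $ 1 - \<alpha>"])
qed

text \<open>No cell passes through a vertex in its relative interior; hence a vertex contained in a
  cell is a face of it.\<close>

lemma extreme_point_of_cell:
  assumes "C \<in> cells"
  shows "x extreme_point_of C \<longleftrightarrow> x \<in> C \<and> x \<in> vertices"
proof
  assume x: "x extreme_point_of C"
  from assms have "x \<in> vertices"
  proof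
    assume "C \<in> bounded_cells \<alpha>"
    then obtain P Q where "P \<in> vertices" "Q \<in> vertices" "C = closed_segment P Q"
      by (elim bounded_cell_cases)
    then show ?thesis
      using x by (auto simp: extreme_point_of_segment)
  next
    assume "C \<in> unbounded_cells \<alpha>"
    then obtain P d where "P \<in> vertices" "d \<noteq> 0" "C = ray_or_segment P d {0..}"
      by (elim unbounded_cell_cases)
    then show ?thesis
      using x by (simp add: extreme_point_of_ray)
  qed
  then show "x \<in> C \<and> x \<in> vertices"
    using x by (simp add: extreme_point_of_def)
next
  assume "x \<in> C \<and> x \<in> vertices"
  then have x: "x \<in> C" "x \<in> vertices"
    by auto
  have coords: "vertex0 $ 1 = 0" "vertex0 $ 2 = 0" "vertex1 \<alpha> $ 1 = \<alpha>" "vertex1 \<alpha> $ 2 = \<alpha>"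
    "vertex2 \<alpha> $ 1 = \<alpha>" "vertex2 \<alpha> $ 2 = 2 * \<alpha>"
    by (simp_all add: vertex0_def vertex1_def vertex2_def)
  have d: "vector [- 2, - 3] \<noteq> (0 :: real ^ 2)" "vector [1, 0] \<noteq> (0 :: real ^ 2)" "vector [1, 3] \<noteq> (0 :: real ^ 2)"
    by (simp_all add: vec_eq_iff forall_2)
  have ends: "vertex0 + \<alpha> *\<^sub>R vector [1, 1] = vertex1 \<alpha>" "vertex0 + \<alpha> *\<^sub>R vector [1, 2] = vertex2 \<alpha>"
    "vertex1 \<alpha> + \<alpha> *\<^sub>R vector [0, 1] = vertex2 \<alpha>"
    by (simp_all add: vertex0_def vertex1_def vertex2_def vec_eq_iff forall_2)
  consider "C = ray_or_segment vertex0 (vector [1, 1]) {0..\<alpha>}"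
    | "C = ray_or_segment vertex0 (vector [1, 2]) {0..\<alpha>}"
    | "C = ray_or_segment (vertex1 \<alpha>) (vector [0, 1]) {0..\<alpha>}"
    | "C = ray_or_segment vertex0 (vector [- 2, - 3]) {0..}"
    | "C = ray_or_segment (vertex1 \<alpha>) (vector [1, 0]) {0..}"
    | "C = ray_or_segment (vertex2 \<alpha>) (vector [1, 3]) {0..}"
    using assms unfolding bounded_cells_def unbounded_cells_def by blast
  then show "x extreme_point_of C"
  proof cases
    case 1
    then have "x \<noteq> vertex2 \<alpha>"
      using x(1) \<alpha> by (auto simp: mem_bounded_cells coords)
    then show ?thesis
      using x(2) by (auto simp: 1 ray_or_segment_bounded[OF \<alpha>] ends extreme_point_of_segment)
  next
    case 2
    then have "x \<noteq> vertex1 \<alpha>"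
      using x(1) \<alpha> by (auto simp: mem_bounded_cells coords)
    then show ?thesis
      using x(2) by (auto simp: 2 ray_or_segment_bounded[OF \<alpha>] ends extreme_point_of_segment)
  next
    case 3
    then have "x \<noteq> vertex0"
      using x(1) \<alpha> by (auto simp: mem_bounded_cells coords)
    then show ?thesis
      using x(2) by (auto simp: 3 ray_or_segment_bounded[OF \<alpha>] ends extreme_point_of_segment)
  next
    case 4
    then have "x = vertex0"
      using x \<alpha> by (auto simp: mem_unbounded_cells coords)
    then show ?thesis
      by (simp add: 4 extreme_point_of_ray d)
  next
    case 5
    then have "\<alpha> \<le> x $ 1" "x $ 2 = \<alpha>"
      using x(1) by (simp_all add: mem_unbounded_cells)
    then have "x \<noteq> vertex0" "x \<noteq> vertex2 \<alpha>"
      using \<alpha> coords by auto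
    then have "x = vertex1 \<alpha>"
      using x(2) by simp
    then show ?thesis
      by (simp add: 5 extreme_point_of_ray d)
  next
    case 6
    then have "x = vertex2 \<alpha>"
      using x \<alpha> by (auto simp: mem_unbounded_cells coords)
    then show ?thesis
      by (simp add: 6 extreme_point_of_ray d)
  qed
qed

lemma cells_Int:
  assumes "C \<in> cells" "D \<in> cells" "C \<noteq> D"
  shows "\<exists>P\<in>vertices. C \<inter> D \<subseteq> {P}"
proof -
  define A0 A1 A2 R0 R1 R2 where
    "A0 = ray_or_segment vertex0 (vector [1, 1]) {0..\<alpha>}" and
    "A1 = ray_or_segment vertex0 (vector [1, 2]) {0..\<alpha>}" and
    "A2 = ray_or_segment (vertex1 \<alpha>) (vector [0, 1]) {0..\<alpha>}" and
    "R0 = ray_or_segment vertex0 (vector [- 2, - 3]) {0..}" and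
    "R1 = ray_or_segment (vertex1 \<alpha>) (vector [1, 0]) {0..}" and
    "R2 = ray_or_segment (vertex2 \<alpha>) (vector [1, 3]) {0..}"
  note defs = A0_def A1_def A2_def R0_def R1_def R2_def
  have cells: "cells = {A0, A1, A2, R0, R1, R2}"
    by (simp add: bounded_cells_def unbounded_cells_def defs insert_commute)
  have coords: "vertex0 $ 1 = 0" "vertex0 $ 2 = 0" "vertex1 \<alpha> $ 1 = \<alpha>" "vertex1 \<alpha> $ 2 = \<alpha>"
    "vertex2 \<alpha> $ 1 = \<alpha>" "vertex2 \<alpha> $ 2 = 2 * \<alpha>"
    by (simp_all add: vertex0_def vertex1_def vertex2_def)
  \<comment> \<open>Disjoint pairs are listed here as well; for them \<open>vertex0\<close> is an
    arbitrary choice.\<close>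
  have v0: "A0 \<inter> A1 \<subseteq> {vertex0}" "A0 \<inter> R0 \<subseteq> {vertex0}" "A1 \<inter> R0 \<subseteq> {vertex0}" "A2 \<inter> R0 \<subseteq> {vertex0}"
    "R0 \<inter> R1 \<subseteq> {vertex0}" "R0 \<inter> R2 \<subseteq> {vertex0}" "R1 \<inter> R2 \<subseteq> {vertex0}"
    "A0 \<inter> R2 \<subseteq> {vertex0}" "A1 \<inter> R1 \<subseteq> {vertex0}"
    using \<alpha> by (auto simp: defs mem_bounded_cells mem_unbounded_cells vec_eq_iff forall_2 coords)
  have v1: "A0 \<inter> A2 \<subseteq> {vertex1 \<alpha>}" "A0 \<inter> R1 \<subseteq> {vertex1 \<alpha>}" "A2 \<inter> R1 \<subseteq> {vertex1 \<alpha>}"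
    using \<alpha> by (auto simp: defs mem_bounded_cells mem_unbounded_cells vec_eq_iff forall_2 coords)
  have v2: "A1 \<inter> A2 \<subseteq> {vertex2 \<alpha>}" "A1 \<inter> R2 \<subseteq> {vertex2 \<alpha>}" "A2 \<inter> R2 \<subseteq> {vertex2 \<alpha>}"
    using \<alpha> by (auto simp: defs mem_bounded_cells mem_unbounded_cells vec_eq_iff forall_2 coords)
  show ?thesis
    using assms(3) v0 v1 v2 assms(1,2)
    unfolding cells by (elim insertE emptyE) (simp_all add: Int_commute)
qed

text \<open>A complex has to contain the nonempty faces of its members, so the vertices are added as
  singletons.\<close>

definition graph_cells :: "(real ^ 2) set set" where
  "graph_cells = cells \<union> (\<lambda>P. {P}) ` vertices"

lemma graph_cell_cases:
  assumes "C \<in> graph_cells"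
  obtains "C \<in> cells" | P where "P \<in> vertices" "C = {P}"
  using assms unfolding graph_cells_def by blast

lemma polyhedral_complex_graph_cells: "polyhedral_complex graph_cells"
  unfolding polyhedral_complex_def
proof (intro conjI ballI allI impI)
  show "finite graph_cells"
    by (simp add: graph_cells_def bounded_cells_def unbounded_cells_def)
next
  fix C assume "C \<in> graph_cells"
  then show "polyhedron C"
  proof (cases rule: graph_cell_cases)
    case 1
    then show ?thesis by (rule polyhedron_cell)
  next
    case (2 P)
    then show ?thesis using polyhedron_convex_hull[of "{P}"] by simp
  qed
next
  fix C assume "C \<in> graph_cells"
  then show "C \<noteq> {}"
    by (cases rule: graph_cell_cases) (use aff_dim_cell in force)+
next
  fix C F assume C: "C \<in> graph_cells" and F: "F face_of C" "F \<noteq> {}"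
  from C show "F \<in> graph_cells"
  proof (cases rule: graph_cell_cases)
    case 1
    from nonempty_face_of_aff_dim_1[OF convex_cell[OF 1] aff_dim_cell[OF 1] F] show ?thesis
    proof (elim disjE exE conjE)
      fix P assume "F = {P}" "P extreme_point_of C"
      then show ?thesis
        using extreme_point_of_cell[OF 1] unfolding graph_cells_def by blast
    qed (use C in simp)
  next
    case (2 P)
    then have "F = C"
      using F face_of_imp_subset by blast
    then show ?thesis
      using C by simp
  qed
next
  have face: "{P} face_of C" if "C \<in> graph_cells" "P \<in> C" "P \<in> vertices" for C P
    using that(1)
  proof (cases rule: graph_cell_cases)
    case 1
    then show ?thesis
      using that extreme_point_of_cell[OF 1] by (simp add: face_of_singleton)
  next
    case (2 Q)
    then show ?thesis
      using that by (simp add: face_of_refl)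
  qed
  \<comment> \<open>Each alternative is a face of both cells: the empty set, the whole cell, or a
    vertex by \<open>face\<close>.\<close>
  have Int: "C \<inter> D = {} \<or> C = D \<or> (\<exists>P\<in>vertices. C \<inter> D = {P})"
    if "C \<in> graph_cells" "D \<in> graph_cells" for C D
  proof (cases "C \<in> cells \<and> D \<in> cells")
    case True
    then show ?thesis
      using cells_Int[of C D] by blast
  next
    case False
    then show ?thesis
      using that unfolding graph_cells_def by blast
  qed
  have convex: "convex C" if "C \<in> graph_cells" for C
    using that by (cases rule: graph_cell_cases) (use convex_cell in auto)
  fix C D assume CD: "C \<in> graph_cells" "D \<in> graph_cells"
  from Int[OF this] have "C \<inter> D face_of C \<and> C \<inter> D face_of D"
  proof (elim disjE bexE)
    fix P assume P: "P \<in> vertices" "C \<inter> D = {P}"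
    then have "P \<in> C" "P \<in> D"
      by blast+
    then show ?thesis
      using P face CD by simp
  qed (use CD convex in \<open>simp_all add: face_of_refl\<close>)
  then show "C \<inter> D face_of C" "C \<inter> D face_of D"
    by simp_all
qed

lemma edges_graph_cells: "edges graph_cells = cells"
  unfolding edges_def graph_cells_def using aff_dim_cell by auto

lemma graph_structure_graph_cells: "graph_structure (\<Union>cells) graph_cells"
  unfolding graph_structure_def edges_graph_cells
proof (intro conjI ballI polyhedral_complex_graph_cells rational_slope_cell)
  have "\<exists>C\<in>bounded_cells \<alpha>. P \<in> C" if "P \<in> vertices" for P
    using that unfolding bounded_cells_closed_segment by auto
  then have vertex: "\<exists>C\<in>cells. P \<in> C" if "P \<in> vertices" for P
    using that by blast
  then show "\<Union>graph_cells = \<Union>cells"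
    unfolding graph_cells_def by blast
  show "\<exists>e\<in>cells. C \<subseteq> e" if "C \<in> graph_cells" for C
    using that vertex unfolding graph_cells_def by blast
qed

section \<open>The cycle and its length\<close>

lemma edge_ends_segment: "edge_ends (closed_segment P Q) = {P, Q}" for P Q :: "real ^ 2"
  by (auto simp: edge_ends_def extreme_point_of_segment)

lemma is_cycle_bounded_cells: "is_cycle graph_cells (bounded_cells \<alpha>)"
proof -
  let ?S = "bounded_cells \<alpha>" and ?V = vertices
  let ?e01 = "closed_segment vertex0 (vertex1 \<alpha>)" and ?e02 = "closed_segment vertex0 (vertex2 \<alpha>)"
    and ?e12 = "closed_segment (vertex1 \<alpha>) (vertex2 \<alpha>)"
  have distinct: "?e01 \<noteq> ?e02" "?e01 \<noteq> ?e12" "?e02 \<noteq> ?e12"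
    using vertices_distinct by (auto simp: doubleton_eq_iff)
  have card_S: "card ?S = 3"
    using distinct by (simp add: bounded_cells_closed_segment)
  have finite: "finite ?S"
    by (simp add: bounded_cells_def)
  have verts: "verts ?S = ?V"
    by (auto simp: verts_def bounded_cells_closed_segment edge_ends_segment)
  have card_V: "card ?V = 3"
    using vertices_distinct by simp
  \<comment> \<open>Any two vertices of a triangle share an edge, so the relation is total already
    before the closure is taken, and there is one component.\<close>
  have "(p, q) \<in> {(p, q). \<exists>e\<in>?S. p \<in> edge_ends e \<and> q \<in> edge_ends e}" if "p \<in> ?V" "q \<in> ?V" for p q
    using that by (auto simp: bounded_cells_closed_segment edge_ends_segment)
  then have joined: "joined ?S = ?V \<times> ?V"
    unfolding joined_def verts by blast
  have "verts ?S // joined ?S = {?V}"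
    unfolding joined verts by (auto simp: quotient_def)
  then have "betti_number ?S = 1"
    by (simp add: betti_number_def card_S verts card_V)
  moreover have "leafless ?S"
    unfolding leafless_def
  proof
    fix P assume "P \<in> verts ?S"
    then consider "P = vertex0" | "P = vertex1 \<alpha>" | "P = vertex2 \<alpha>"
      unfolding verts by blast
    then obtain C D where "C \<noteq> D" "{C, D} \<subseteq> {e \<in> ?S. P \<in> edge_ends e}"
    proof cases
      case 1
      then show thesis
        using distinct
        by (intro that[of ?e01 ?e02]) (simp_all add: bounded_cells_closed_segment edge_ends_segment)
    next
      case 2
      then show thesis
        using distinct
        by (intro that[of ?e01 ?e12]) (simp_all add: bounded_cells_closed_segment edge_ends_segment)
    next
      case 3
      then show thesis
        using distinct
        by (intro that[of ?e02 ?e12]) (simp_all add: bounded_cells_closed_segment edge_ends_segment)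
    qed
    then have "2 \<le> valence ?S P"
      unfolding valence_def using card_mono[of "{e \<in> ?S. P \<in> edge_ends e}" "{C, D}"] finite by simp
    then show "valence ?S P \<noteq> 1"
      by simp
  qed
  moreover have "?S \<subseteq> bounded_edges graph_cells"
    unfolding bounded_edges_def edges_graph_cells
    by (auto simp: bounded_cells_closed_segment intro: bounded_closed_segment)
  moreover have "graph_connected ?S"
    by (simp add: graph_connected_def joined verts)
  ultimately show ?thesis
    using finite by (simp add: is_cycle_def)
qed

lemma sum_lattice_length_bounded_cells: "(\<Sum>e\<in>bounded_cells \<alpha>. lattice_length e) = 3 * \<alpha>"
proof -
  have "lattice_length e = \<alpha>" if "e \<in> bounded_cells \<alpha>" for e
    \<comment> \<open>The index 1, 1 or 2 selects a coordinate of the direction that equals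
      1.\<close>
    using that \<alpha> lattice_length_unit_direction[of "vector [1, 1] :: int ^ 2" 1 \<alpha> vertex0]
      lattice_length_unit_direction[of "vector [1, 2] :: int ^ 2" 1 \<alpha> vertex0]
      lattice_length_unit_direction[of "vector [0, 1] :: int ^ 2" 2 \<alpha> "vertex1 \<alpha>"]
    by (auto simp: bounded_cells_def ray_or_segment_bounded of_int_vec_2)
  moreover have "card (bounded_cells \<alpha>) = 3"
    using vertices_distinct by (simp add: bounded_cells_closed_segment doubleton_eq_iff)
  ultimately show ?thesis
    by simp
qed

lemma contains_cycle_cells: "contains_cycle_of_length (\<Union>cells) (3 * \<alpha>)"
  unfolding contains_cycle_of_length_def
  using graph_structure_graph_cells is_cycle_bounded_cells sum_lattice_length_bounded_cells by blast

end


section \<open>The curve with given \<open>j\<close>-invariant\<close>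

text \<open>For a \<noteq> 0 the origin is a flex with tangent y = 0, hence a point of order three;
  the coefficient of xy is normalized to 1.\<close>

definition cubic_weierstrass :: "'a::field \<Rightarrow> 'a weierstrass" where
  "cubic_weierstrass a = \<lparr>a1 = 1, a2 = 0, a3 = a, a4 = 0, a6 = 0\<rparr>"

lemma discriminant_cubic_weierstrass: "discriminant (cubic_weierstrass a) = a ^ 3 * (1 - 27 * a)"
  by (simp add: cubic_weierstrass_def discriminant_def b2_def b4_def b6_def b8_def
      power2_eq_square power3_eq_cube algebra_simps)

lemma c4_cubic_weierstrass: "c4 (cubic_weierstrass a) = 1 - 24 * a"
  by (simp add: cubic_weierstrass_def c4_def b2_def b4_def)

lemma torus_part_cubic_weierstrass: "torus_part (weierstrass_curve (cubic_weierstrass a)) = cubic_points a"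
proof -
  have "proj_pt (vector [t $ 1, t $ 2, 1]) \<in> weierstrass_curve (cubic_weierstrass a) \<longleftrightarrow>
      (t $ 2) ^ 2 + t $ 1 * t $ 2 + a * t $ 2 = (t $ 1) ^ 3" for t :: "'a ^ 2"
    by (subst proj_pt_mem_weierstrass_curve)
      (simp_all add: vec_eq_iff forall_3 weierstrass_form_def cubic_weierstrass_def)
  then show ?thesis
    by (simp add: torus_part_def cubic_points_def)
qed

context valuation
begin

text \<open>Clearing denominators in the formula for \<open>j\<close> gives a quartic in
  \<open>a\<close>. At -v(j)/3 its terms of degree 0 and 3 tie with value 0, while the remaining
  nonzero terms have positive value.\<close>

lemma exists_cubic_weierstrass_j_invariant:
  assumes "j \<noteq> 0" "v j < 0"
  obtains a where "a \<noteq> 0" "3 * v a = - v j"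
    and "is_elliptic (cubic_weierstrass a)" "j_invariant (cubic_weierstrass a) = j"
proof -
  define w where "w = - v j / 3"
  \<comment> \<open>As 13824 = 24^3, the polynomial \<open>?p\<close> is the expansion of (1 - 24
    X)^3 - j X^3 (1 - 27 X).\<close>
  define c where "c = j + 13824"
  let ?p = "[:1, - 72, 1728, - c, 27 * j:]"
  have num: "(numeral n :: 'a) = 0 \<or> 0 \<le> v (numeral n)" for n
    using v_ge_numeral[of n] by (simp add: v_ge_def)
  have nums: "(27 :: 'a) = 0 \<or> 0 \<le> v 27" "(72 :: 'a) = 0 \<or> 0 \<le> v 72"
    "(1728 :: 'a) = 0 \<or> 0 \<le> v 1728" "(13824 :: 'a) = 0 \<or> 0 \<le> v 13824"
    by (rule num)+
  have c3: "c \<noteq> 0" "v c = v j"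
    unfolding c_def using v_add_less[of j 13824] assms nums(4)
    by auto
  obtain a where a: "a \<noteq> 0" "poly ?p a = 0" "v a = w"
  proof (rule newton_polygon_root[of 0 3 ?p w 0])
    show "0 \<le> v (coeff ?p k) + k * w" if k: "k \<le> degree ?p" "coeff ?p k \<noteq> 0" for k
    proof -
      have w: "w > 0" "3 * w = - v j"
        using assms by (simp_all add: w_def)
      \<comment> \<open>Only a bound, since \<open>27 * j\<close> vanishes in characteristic
        three.\<close>
      have "degree ?p \<le> 4"
        by simp
      then consider "k = 0" | "k = 1" | "k = 2" | "k = 3" | "k = 4"
        using k(1) by linarith
      then show ?thesis
      proof cases
        case 5
        then have "(27 :: 'a) \<noteq> 0"
          using k(2) by (auto simp: eval_nat_numeral)
        then show ?thesis
          using 5 w nums(1) assms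
          by (simp add: v_mult eval_nat_numeral)
      qed (use k(2) w c3 nums(2,3)
          in \<open>auto simp: eval_nat_numeral\<close>)
    qed
  qed (use c3 assms in \<open>simp_all add: eval_nat_numeral w_def\<close>)
  have "3 * v a = - v j"
    using a(3) by (simp add: w_def)
  have eq: "(1 - 24 * a) ^ 3 = j * (a ^ 3 * (1 - 27 * a))"
    using a(2) by (simp add: c_def power3_eq_cube algebra_simps)
  \<comment> \<open>As v a > 0, the summand 1 dominates. For the numeral 27 this makes the
    discriminant nonzero.\<close>
  have nz: "1 - numeral n * a \<noteq> 0" for n
  proof -
    have "v a > 0"
      using a(3) assms by (simp add: w_def)
    then have "- (numeral n * a) = 0 \<or> v 1 < v (- (numeral n * a))"
      using num[of n] a(1) by (cases "(numeral n :: 'a) = 0") (auto simp: v_mult)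
    from v_add_less(1)[OF one_neq_zero this] show ?thesis
      by simp
  qed
  then have "discriminant (cubic_weierstrass a) \<noteq> 0"
    using a(1) by (simp add: discriminant_cubic_weierstrass)
  then have "j_invariant (cubic_weierstrass a) = j" "is_elliptic (cubic_weierstrass a)"
    using eq by (simp_all add: j_invariant_def is_elliptic_def c4_cubic_weierstrass
        discriminant_cubic_weierstrass)
  with a(1) \<open>3 * v a = - v j\<close> show thesis
    by (intro that)
qed

end

theorem theorem1p1:
  fixes v :: "'a::alg_closed_field \<Rightarrow> real" and E :: "'a weierstrass"
  assumes "is_valuation v"
    and "ring_char (residue_field v) \<noteq> 2" and "ring_char (residue_field v) \<noteq> 3"
    and "is_elliptic E"
    and "j_invariant E \<noteq> 0" and "v (j_invariant E) < 0"
  shows "\<exists>\<phi> :: ('a, 3) pt \<Rightarrow> ('a, 3) pt.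
           closed_embedding (weierstrass_curve E) \<phi> \<and>
           contains_cycle_of_length (tropicalization v (weierstrass_curve E) \<phi>)
             (- v (j_invariant E))"
proof -
  interpret valuation v
    by unfold_locales (rule assms(1))
  obtain a where a: "a \<noteq> 0" "3 * v a = - v (j_invariant E)"
    and ell: "is_elliptic (cubic_weierstrass a)"
    and j: "j_invariant (cubic_weierstrass a) = j_invariant E"
    using exists_cubic_weierstrass_j_invariant[OF assms(5,6)] .
  \<comment> \<open>Integers have nonnegative valuation, which separates \<open>j\<close> from
    1728.\<close>
  have "v_ge 1728 0"
    by (rule v_ge_numeral)
  then have "j_invariant E \<noteq> 1728"
    using assms(5,6) by (auto simp: v_ge_def)
  then have "linearly_equivalent E (cubic_weierstrass a)"
    using two_neq_zero[OF assms(2)] three_neq_zero[OF assms(3)] assms(4,5) ell j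
    by (intro linearly_equivalent_if_j_invariant_eq) auto
  then obtain \<phi> where \<phi>: "closed_embedding (weierstrass_curve E) \<phi>"
    and image: "\<phi> ` weierstrass_curve E = weierstrass_curve (cubic_weierstrass a)"
    by (rule linearly_equivalent_imp_closed_embedding)
  have "v a > 0"
    using a(2) assms(6) by simp
  \<comment> \<open>The embedding enters the tropicalization only through its image.\<close>
  then have "tropicalization v (weierstrass_curve E) \<phi> = \<Union>(bounded_cells (v a) \<union> unbounded_cells (v a))"
    using trop_variety_cubic_points[OF a(1) refl]
    by (simp add: tropicalization_def image torus_part_cubic_weierstrass)
  then show ?thesis
    using \<phi> contains_cycle_cells[OF \<open>v a > 0\<close>] a(2) by (intro exI[of _ \<phi>]) simp
qed

end
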